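(* Let $\mathcal{D}$ be a small extriangulated category with negative first extension, let $V\in\mathcal{D}$ be an extended tilting object in $\mathcal{D}$, and let $(\mathcal{T},\mathcal{F}):=(\mathrm{Gen}(V),V^{\perp_0})$. Then $\mathrm{pd}(V)\le 1$ if any of the following conditions holds. (a) Every $F\in\mathcal{F}\cap V^{\perp_1}$ admits an $\mathfrak{s}$-conflation $F\to T\to C'$ with $T\in\mathcal{T}\setminus\{0\}$. (b) Every $\mathfrak{s}$-conflation $F\to 0\to C'$ with $F\in\mathcal{F}\cap V^{\perp_1}$ satisfies $C'\in\mathcal{F}\cap V^{\perp_1}$. (c) $\mathcal{T}=V^{\perp_1}$ (for example, this holds when $\mathcal{D}$ is an exact category).
   Context: Extriangulated categories $(\mathcal{D},\mathbb{E},\mathfrak{s})$ are in the sense of Nakaoka–Palu; an $\mathfrak{s}$-conflation (= $\mathbb{E}$-triangle) is a sequence $A\to B\to C$ realizing an element of $\mathbb{E}(C,A)$. An exact category is regarded as extriangulated with $\mathbb{E}=\mathrm{Ext}^1$ and $\mathbb{E}^{-1}=0$. $\mathcal{D}$ has negative first extension if there are an additive bifunctor $\mathbb{E}^{-1}:\mathcal{D}^{op}\times\mathcal{D}\to\mathrm{Ab}$ and, for each $\delta\in\mathbb{E}(C,A)$, natural transformations $\delta^{-1}:\mathbb{E}^{-1}(-,C)\to\mathcal{D}(-,A)$ and $\delta_{-1}:\mathbb{E}^{-1}(A,-)\to\mathcal{D}(C,-)$ such that, for each $\mathfrak{s}$-conflation $A\to B\to C$ realizing $\delta$ and each $W\in\mathcal{D}$,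 the sequences $\mathbb{E}^{-1}(W,A)\to\mathbb{E}^{-1}(W,B)\to\mathbb{E}^{-1}(W,C)\xrightarrow{\delta^{-1}}\mathcal{D}(W,A)\to\mathcal{D}(W,B)$ and $\mathbb{E}^{-1}(C,W)\to\mathbb{E}^{-1}(B,W)\to\mathbb{E}^{-1}(A,W)\xrightarrow{\delta_{-1}}\mathcal{D}(C,W)\to\mathcal{D}(B,W)$ are exact. Put $\mathbb{E}^1=\mathbb{E}$, $\mathbb{E}^0=\mathrm{Hom}_{\mathcal{D}}$. An $s$-torsion pair in $\mathcal{D}$ is a pair $(\mathcal{T},\mathcal{F})$ of full isomorphism-closed subcategories with $\mathcal{D}(\mathcal{T},\mathcal{F})=0$, $\mathbb{E}^{-1}(\mathcal{T},\mathcal{F})=0$, and such that every $D\in\mathcal{D}$ admits an $\mathfrak{s}$-conflation $T\to D\to F$ with $T\in\mathcal{T}$, $F\in\mathcal{F}$. For $V\in\mathcal{D}$: $V^{\perp_i}=\{X\in\mathcal{D}:\mathbb{E}^i(V,X)=0\}$. $\mathrm{Gen}(V)$ is the class of $X$ such that $X=0$ or there is an $\mathfrak{s}$-conflation $A\to\coprod_\alpha V\xrightarrow{f}X$ for some set $\alpha$ (for which the coproduct exists) with $f\ne0$; $\mathrm{Pres}(V)$ is the class of $X$ such that $X=0$ or there is such a conflation with moreover $A\in\mathrm{Gen}(V)$. A class $\mathcal{S}$ is cogenerating in $\mathcal{D}$ if every $X\in\mathcal{D}$ admits an $\mathfrak{s}$-conflation $X\to S\to X'$ with $S\in\mathcal{S}$.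 $V$ is extended tilting if (T1) $(\mathrm{Gen}(V),V^{\perp_0})$ is an $s$-torsion pair in $\mathcal{D}$; (T2) $\mathrm{Gen}(V)=\mathrm{Pres}(V)$ and $\mathrm{Gen}(V)\subseteq V^{\perp_1}$; (T3) $\mathrm{Gen}(V)$ is cogenerating in $\mathcal{D}$. Higher extensions (Gorsky–Nakaoka–Palu) for small $\mathcal{D}$: for $n\ge1$, $\mathbb{E}^{n+1}(A,B)=\left(\coprod_{C\in\mathcal{D}}\mathbb{E}(C,B)\times\mathbb{E}^n(A,C)\right)/\approx$, where $\approx$ is the equivalence relation generated by $(\delta'\cdot f,\eta)\sim(\delta',f\cdot\eta)$ for all $f:X\to Y$, $\delta'\in\mathbb{E}(Y,B)$, $\eta\in\mathbb{E}^n(A,X)$ (here $\delta'\cdot f=\mathbb{E}(f,B)(\delta')$ and $f\cdot\eta=\mathbb{E}^n(A,f)(\eta)$), with functoriality $\overline{(\delta,\eta)}\cdot\alpha=\overline{(\delta,\eta\cdot\alpha)}$, $\beta\cdot\overline{(\delta,\eta)}=\overline{(\beta\cdot\delta,\eta)}$, and Baer sum $\overline{(\delta,\eta)}+\overline{(\delta',\eta')}=\overline{(\delta\cdot\pi_1+\delta'\cdot\pi_2,\ \mu_1\cdot\eta+\mu_2\cdot\eta')}$ (middle object $X\amalg Y$ with projections $\pi_i$ and inclusions $\mu_i$) as abelian group structure. The projective dimension is $\mathrm{pd}(V)=\min\{k\in\mathbb{N}:\mathbb{E}^{k+1}(V,-)=0\}$ (with $0\in\mathbb N$), and $\infty$ if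 no such $k$ exists. *)

theory Defs
  imports "HOL-Algebra.Elementary_Groups" "HOL-Library.Extended_Nat"
begin

section \<open>Additive categories and additive bifunctors\<close>

text \<open>
  A small category is given by a set of objects, Hom-groups, identities and a composition.
  Abelian groups are HOL-Algebra groups, hence written multiplicatively: \<open>\<otimes>\<close> is the sum and
  \<open>\<one>\<close> is zero.  The Hom-sets need not be disjoint, but composition and the actions of
  morphisms below depend on the morphisms only; tagging morphisms with source and
  target brings any small category into this form.
\<close>

record ('o, 'm) add_cat =
  Ob :: "'o set"
  Hom :: "'o \<Rightarrow> 'o \<Rightarrow> 'm monoid"
  Idt :: "'o \<Rightarrow> 'm"
  Cmp :: "'m \<Rightarrow> 'm \<Rightarrow> 'm"  (infixl "\<odot>\<index>" 75)

abbreviation Mor :: "('o, 'm, 'z) add_cat_scheme \<Rightarrow> 'o \<Rightarrow> 'o \<Rightarrow> 'm set"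
  where "Mor D A B \<equiv> carrier (Hom D A B)"

definition zero_object :: "('o, 'm, 'z) add_cat_scheme \<Rightarrow> 'o \<Rightarrow> bool"
  where "zero_object D Z \<longleftrightarrow> Z \<in> Ob D \<and>
    (\<forall>X\<in>Ob D. trivial_group (Hom D Z X) \<and> trivial_group (Hom D X Z))"

definition isomorphism :: "('o, 'm, 'z) add_cat_scheme \<Rightarrow> 'o \<Rightarrow> 'o \<Rightarrow> 'm \<Rightarrow> bool"
  where "isomorphism D A B f \<longleftrightarrow> f \<in> Mor D A B \<and>
    (\<exists>g\<in>Mor D B A. g \<odot>\<^bsub>D\<^esub> f = Idt D A \<and> f \<odot>\<^bsub>D\<^esub> g = Idt D B)"

definition is_biproduct ::
    "('o, 'm, 'z) add_cat_scheme \<Rightarrow> 'o \<Rightarrow> 'o \<Rightarrow> 'o \<times> 'm \<times> 'm \<times> 'm \<times> 'm \<Rightarrow> bool"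
  where "is_biproduct D A B = (\<lambda>(S, i1, i2, p1, p2).
    S \<in> Ob D \<and> i1 \<in> Mor D A S \<and> i2 \<in> Mor D B S \<and> p1 \<in> Mor D S A \<and> p2 \<in> Mor D S B \<and>
    p1 \<odot>\<^bsub>D\<^esub> i1 = Idt D A \<and> p2 \<odot>\<^bsub>D\<^esub> i2 = Idt D B \<and>
    p1 \<odot>\<^bsub>D\<^esub> i2 = \<one>\<^bsub>Hom D B A\<^esub> \<and> p2 \<odot>\<^bsub>D\<^esub> i1 = \<one>\<^bsub>Hom D A B\<^esub> \<and>
    (i1 \<odot>\<^bsub>D\<^esub> p1) \<otimes>\<^bsub>Hom D S S\<^esub> (i2 \<odot>\<^bsub>D\<^esub> p2) = Idt D S)"

locale additive_category =
  fixes D :: "('o, 'm, 'z) add_cat_scheme" (structure)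
  assumes Hom_comm_group: "\<lbrakk>A \<in> Ob D; B \<in> Ob D\<rbrakk> \<Longrightarrow> comm_group (Hom D A B)"
    and Idt_closed: "A \<in> Ob D \<Longrightarrow> Idt D A \<in> Mor D A A"
    and Cmp_closed:
      "\<lbrakk>A \<in> Ob D; B \<in> Ob D; C \<in> Ob D; f \<in> Mor D A B; g \<in> Mor D B C\<rbrakk>
        \<Longrightarrow> g \<odot> f \<in> Mor D A C"
    and Cmp_Idt_left: "\<lbrakk>A \<in> Ob D; B \<in> Ob D; f \<in> Mor D A B\<rbrakk> \<Longrightarrow> Idt D B \<odot> f = f"
    and Cmp_Idt_right: "\<lbrakk>A \<in> Ob D; B \<in> Ob D; f \<in> Mor D A B\<rbrakk> \<Longrightarrow> f \<odot> Idt D A = f"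
    and Cmp_assoc:
      "\<lbrakk>A \<in> Ob D; B \<in> Ob D; C \<in> Ob D; X \<in> Ob D;
        f \<in> Mor D A B; g \<in> Mor D B C; h \<in> Mor D C X\<rbrakk>
        \<Longrightarrow> (h \<odot> g) \<odot> f = h \<odot> (g \<odot> f)"
    and Cmp_add_left:
      "\<lbrakk>A \<in> Ob D; B \<in> Ob D; C \<in> Ob D; f \<in> Mor D A B; g \<in> Mor D B C; g' \<in> Mor D B C\<rbrakk>
        \<Longrightarrow> (g \<otimes>\<^bsub>Hom D B C\<^esub> g') \<odot> f = (g \<odot> f) \<otimes>\<^bsub>Hom D A C\<^esub> (g' \<odot> f)"
    and Cmp_add_right:
      "\<lbrakk>A \<in> Ob D; B \<in> Ob D; C \<in> Ob D; f \<in> Mor D A B; f' \<in> Mor D A B; g \<in> Mor D B C\<rbrakk>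
        \<Longrightarrow> g \<odot> (f \<otimes>\<^bsub>Hom D A B\<^esub> f') = (g \<odot> f) \<otimes>\<^bsub>Hom D A C\<^esub> (g \<odot> f')"
    and zero_object_exists: "\<exists>Z. zero_object D Z"
    and biproduct_exists: "\<lbrakk>A \<in> Ob D; B \<in> Ob D\<rbrakk> \<Longrightarrow> \<exists>b. is_biproduct D A B b"

text \<open>
  An additive bifunctor from \<open>D\<^sup>o\<^sup>p \<times> D\<close> to abelian groups: for \<open>c : C' \<rightarrow> C\<close> and
  \<open>a : A \<rightarrow> A'\<close>, \<open>Fm c a\<close> is the map \<open>F(c, a) : F(C, A) \<rightarrow> F(C', A')\<close>.
\<close>

locale additive_bifunctor = additive_category D
  for D :: "('o, 'm, 'z) add_cat_scheme" (structure) +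
  fixes F :: "'o \<Rightarrow> 'o \<Rightarrow> 'x monoid"
    and Fm :: "'m \<Rightarrow> 'm \<Rightarrow> 'x \<Rightarrow> 'x"
  assumes F_comm_group: "\<lbrakk>C \<in> Ob D; A \<in> Ob D\<rbrakk> \<Longrightarrow> comm_group (F C A)"
    and Fm_hom:
      "\<lbrakk>C \<in> Ob D; C' \<in> Ob D; A \<in> Ob D; A' \<in> Ob D; c \<in> Mor D C' C; a \<in> Mor D A A'\<rbrakk>
        \<Longrightarrow> Fm c a \<in> hom (F C A) (F C' A')"
    and Fm_Idt:
      "\<lbrakk>C \<in> Ob D; A \<in> Ob D; x \<in> carrier (F C A)\<rbrakk> \<Longrightarrow> Fm (Idt D C) (Idt D A) x = x"
    and Fm_Cmp:
      "\<lbrakk>C \<in> Ob D; C' \<in> Ob D; C'' \<in> Ob D; A \<in> Ob D; A' \<in> Ob D; A'' \<in> Ob D;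
        c \<in> Mor D C' C; c' \<in> Mor D C'' C'; a \<in> Mor D A A'; a' \<in> Mor D A' A'';
        x \<in> carrier (F C A)\<rbrakk>
        \<Longrightarrow> Fm (c \<odot> c') (a' \<odot> a) x = Fm c' a' (Fm c a x)"
    and Fm_add_left:
      "\<lbrakk>C \<in> Ob D; C' \<in> Ob D; A \<in> Ob D; A' \<in> Ob D;
        c \<in> Mor D C' C; c' \<in> Mor D C' C; a \<in> Mor D A A'; x \<in> carrier (F C A)\<rbrakk>
        \<Longrightarrow> Fm (c \<otimes>\<^bsub>Hom D C' C\<^esub> c') a x = Fm c a x \<otimes>\<^bsub>F C' A'\<^esub> Fm c' a x"
    and Fm_add_right:
      "\<lbrakk>C \<in> Ob D; C' \<in> Ob D; A \<in> Ob D; A' \<in> Ob D;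
        c \<in> Mor D C' C; a \<in> Mor D A A'; a' \<in> Mor D A A'; x \<in> carrier (F C A)\<rbrakk>
        \<Longrightarrow> Fm c (a \<otimes>\<^bsub>Hom D A A'\<^esub> a') x = Fm c a x \<otimes>\<^bsub>F C' A'\<^esub> Fm c a' x"


section \<open>Extriangulated categories\<close>

text \<open>
  \<open>Ext D C A\<close> is the group \<open>\<E>(C, A)\<close>, and \<open>Rlz D C A \<delta>\<close> is \<open>\<ss>(\<delta>)\<close> for \<open>\<delta> \<in> \<E>(C, A)\<close>: an
  equivalence class of sequences \<open>A \<rightarrow> B \<rightarrow> C\<close>, each recorded as \<open>(B, x, y)\<close>.
\<close>

record ('o, 'm, 'e) extri_cat = "('o, 'm) add_cat" +
  Ext :: "'o \<Rightarrow> 'o \<Rightarrow> 'e monoid"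
  ExtMap :: "'m \<Rightarrow> 'm \<Rightarrow> 'e \<Rightarrow> 'e"
  Rlz :: "'o \<Rightarrow> 'o \<Rightarrow> 'e \<Rightarrow> ('o \<times> 'm \<times> 'm) set"

definition seqs :: "('o, 'm, 'z) add_cat_scheme \<Rightarrow> 'o \<Rightarrow> 'o \<Rightarrow> ('o \<times> 'm \<times> 'm) set"
  where "seqs D A C = {(B, x, y). B \<in> Ob D \<and> x \<in> Mor D A B \<and> y \<in> Mor D B C}"

definition seq_equiv ::
    "('o, 'm, 'z) add_cat_scheme \<Rightarrow> 'o \<Rightarrow> 'o \<Rightarrow> (('o \<times> 'm \<times> 'm) \<times> ('o \<times> 'm \<times> 'm)) set"
  where "seq_equiv D A C = {((B, x, y), (B', x', y')).
    (B, x, y) \<in> seqs D A C \<and> (B', x', y') \<in> seqs D A C \<and>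
    (\<exists>b. isomorphism D B B' b \<and> b \<odot>\<^bsub>D\<^esub> x = x' \<and> y' \<odot>\<^bsub>D\<^esub> b = y)}"

text \<open>\<open>\<delta> \<cdot> c = \<E>(c, A)(\<delta>)\<close> and \<open>a \<cdot> \<delta> = \<E>(C, a)(\<delta>)\<close> for \<open>\<delta> \<in> \<E>(C, A)\<close>.\<close>

definition pull :: "('o, 'm, 'e, 'z) extri_cat_scheme \<Rightarrow> 'o \<Rightarrow> 'e \<Rightarrow> 'm \<Rightarrow> 'e"
  where "pull D A \<delta> c = ExtMap D c (Idt D A) \<delta>"

definition push :: "('o, 'm, 'e, 'z) extri_cat_scheme \<Rightarrow> 'o \<Rightarrow> 'm \<Rightarrow> 'e \<Rightarrow> 'e"
  where "push D C a \<delta> = ExtMap D (Idt D C) a \<delta>"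

text \<open>\<open>etriangle D A B C x y \<delta>\<close>: the sequence \<open>A \<rightarrow> B \<rightarrow> C\<close> with maps \<open>x\<close>, \<open>y\<close> realizes \<open>\<delta>\<close>.\<close>

definition etriangle ::
    "('o, 'm, 'e, 'z) extri_cat_scheme \<Rightarrow> 'o \<Rightarrow> 'o \<Rightarrow> 'o \<Rightarrow> 'm \<Rightarrow> 'm \<Rightarrow> 'e \<Rightarrow> bool"
  where "etriangle D A B C x y \<delta> \<longleftrightarrow>
    A \<in> Ob D \<and> B \<in> Ob D \<and> C \<in> Ob D \<and> x \<in> Mor D A B \<and> y \<in> Mor D B C \<and>
    \<delta> \<in> carrier (Ext D C A) \<and> (B, x, y) \<in> Rlz D C A \<delta>"

definition conflation ::
    "('o, 'm, 'e, 'z) extri_cat_scheme \<Rightarrow> 'o \<Rightarrow> 'o \<Rightarrow> 'o \<Rightarrow> 'm \<Rightarrow> 'm \<Rightarrow> bool"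
  where "conflation D A B C x y \<longleftrightarrow> (\<exists>\<delta>. etriangle D A B C x y \<delta>)"

locale extriangulated_category =
  additive_bifunctor D "Ext D" "ExtMap D"
  for D :: "('o, 'm, 'e, 'z) extri_cat_scheme" (structure) +
  assumes Rlz_class:
      "\<lbrakk>A \<in> Ob D; C \<in> Ob D; \<delta> \<in> carrier (Ext D C A)\<rbrakk>
        \<Longrightarrow> Rlz D C A \<delta> \<in> seqs D A C // seq_equiv D A C"
    and Rlz_morphism:
      "\<lbrakk>etriangle D A B C x y \<delta>; etriangle D A' B' C' x' y' \<delta>';
        a \<in> Mor D A A'; c \<in> Mor D C C'; push D C a \<delta> = pull D A' \<delta>' c\<rbrakk>
        \<Longrightarrow> \<exists>b\<in>Mor D B B'. b \<odot> x = x' \<odot> a \<and> y' \<odot> b = c \<odot> y"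
    and Rlz_zero:
      "\<lbrakk>A \<in> Ob D; C \<in> Ob D; is_biproduct D A C (S, i1, i2, p1, p2)\<rbrakk>
        \<Longrightarrow> (S, i1, p2) \<in> Rlz D C A \<one>\<^bsub>Ext D C A\<^esub>"
    \<comment> \<open>\<open>\<ss>(\<delta> \<oplus> \<delta>') = \<ss>(\<delta>) \<oplus> \<ss>(\<delta>')\<close>, where \<open>\<delta> \<oplus> \<delta>'\<close> is the image of \<open>\<delta>\<close> plus the image of \<open>\<delta>'\<close>
      in \<open>\<E>(C \<oplus> C', A \<oplus> A')\<close>\<close>
    and Rlz_sum:
      "\<lbrakk>etriangle D A B C x y \<delta>; etriangle D A' B' C' x' y' \<delta>';
        is_biproduct D A A' (SA, i1, i2, p1, p2);
        is_biproduct D B B' (SB, j1, j2, q1, q2);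
        is_biproduct D C C' (SC, k1, k2, r1, r2)\<rbrakk>
        \<Longrightarrow> (SB, (j1 \<odot> x \<odot> p1) \<otimes>\<^bsub>Hom D SA SB\<^esub> (j2 \<odot> x' \<odot> p2),
                 (k1 \<odot> y \<odot> q1) \<otimes>\<^bsub>Hom D SB SC\<^esub> (k2 \<odot> y' \<odot> q2))
            \<in> Rlz D SC SA (ExtMap D r1 i1 \<delta> \<otimes>\<^bsub>Ext D SC SA\<^esub> ExtMap D r2 i2 \<delta>')"
    and ET3:
      "\<lbrakk>etriangle D A B C x y \<delta>; etriangle D A' B' C' x' y' \<delta>';
        a \<in> Mor D A A'; b \<in> Mor D B B'; b \<odot> x = x' \<odot> a\<rbrakk>
        \<Longrightarrow> \<exists>c\<in>Mor D C C'. c \<odot> y = y' \<odot> b \<and> push D C a \<delta> = pull D A' \<delta>' c"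
    and ET3_op:
      "\<lbrakk>etriangle D A B C x y \<delta>; etriangle D A' B' C' x' y' \<delta>';
        b \<in> Mor D B B'; c \<in> Mor D C C'; y' \<odot> b = c \<odot> y\<rbrakk>
        \<Longrightarrow> \<exists>a\<in>Mor D A A'. x' \<odot> a = b \<odot> x \<and> push D C a \<delta> = pull D A' \<delta>' c"
    and ET4:
      "\<lbrakk>etriangle D A B X f f' \<delta>; etriangle D B C Y g g' \<delta>'\<rbrakk>
        \<Longrightarrow> \<exists>E h' d e \<delta>''.
              etriangle D A C E (g \<odot> f) h' \<delta>'' \<and>
              d \<in> Mor D X E \<and> e \<in> Mor D E Y \<and>
              d \<odot> f' = h' \<odot> g \<and> e \<odot> h' = g' \<and>
              etriangle D X E Y d e (push D Y f' \<delta>') \<and>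
              pull D A \<delta>'' d = \<delta> \<and>
              push D E f \<delta>'' = pull D B \<delta>' e"
    and ET4_op:
      "\<lbrakk>etriangle D X A B f' f \<delta>; etriangle D Y B C g' g \<delta>'\<rbrakk>
        \<Longrightarrow> \<exists>E h' d e \<delta>''.
              etriangle D E A C h' (g \<odot> f) \<delta>'' \<and>
              d \<in> Mor D X E \<and> e \<in> Mor D E Y \<and>
              h' \<odot> d = f' \<and> g' \<odot> e = f \<odot> h' \<and>
              etriangle D X E Y d e (pull D X \<delta> g') \<and>
              push D C e \<delta>'' = \<delta>' \<and>
              push D B d \<delta> = pull D E \<delta>'' g"


section \<open>Negative first extensions\<close>

text \<open>
  \<open>NExt D\<close> is \<open>\<E>\<^sup>-\<^sup>1\<close>.  For \<open>\<delta> \<in> \<E>(C, A)\<close>, \<open>dsup D C A \<delta> W\<close> is the component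
  \<open>\<E>\<^sup>-\<^sup>1(W, C) \<rightarrow> D(W, A)\<close> of \<open>\<delta>\<^sup>-\<^sup>1\<close>, and \<open>dsub D C A \<delta> W\<close> is the component
  \<open>\<E>\<^sup>-\<^sup>1(A, W) \<rightarrow> D(C, W)\<close> of the transformation \<open>\<delta>\<close> with lower index \<open>-1\<close>.
\<close>

record ('o, 'm, 'e, 'n) neg_extri_cat = "('o, 'm, 'e) extri_cat" +
  NExt :: "'o \<Rightarrow> 'o \<Rightarrow> 'n monoid"
  NExtMap :: "'m \<Rightarrow> 'm \<Rightarrow> 'n \<Rightarrow> 'n"
  dsup :: "'o \<Rightarrow> 'o \<Rightarrow> 'e \<Rightarrow> 'o \<Rightarrow> 'n \<Rightarrow> 'm"
  dsub :: "'o \<Rightarrow> 'o \<Rightarrow> 'e \<Rightarrow> 'o \<Rightarrow> 'n \<Rightarrow> 'm"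

text \<open>Exactness of \<open>G \<rightarrow> H \<rightarrow> K\<close> at \<open>H\<close>.  The library's \<open>exact_seq\<close> needs groups of one type.\<close>

definition exact_at ::
    "('a, 'x) monoid_scheme \<Rightarrow> ('a \<Rightarrow> 'b) \<Rightarrow> ('b, 'y) monoid_scheme \<Rightarrow> ('b \<Rightarrow> 'c) \<Rightarrow>
     ('c, 'w) monoid_scheme \<Rightarrow> bool"
  where "exact_at G f H g K \<longleftrightarrow> f ` carrier G = kernel H K g"

locale neg_extriangulated_category =
  extriangulated_category D + neg: additive_bifunctor D "NExt D" "NExtMap D"
  for D :: "('o, 'm, 'e, 'n, 'z) neg_extri_cat_scheme" (structure) +
  assumes dsup_hom:
      "\<lbrakk>A \<in> Ob D; C \<in> Ob D; W \<in> Ob D; \<delta> \<in> carrier (Ext D C A)\<rbrakk>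
        \<Longrightarrow> dsup D C A \<delta> W \<in> hom (NExt D W C) (Hom D W A)"
    and dsup_natural:
      "\<lbrakk>A \<in> Ob D; C \<in> Ob D; W \<in> Ob D; W' \<in> Ob D; \<delta> \<in> carrier (Ext D C A);
        w \<in> Mor D W' W; u \<in> carrier (NExt D W C)\<rbrakk>
        \<Longrightarrow> dsup D C A \<delta> W' (NExtMap D w (Idt D C) u) = dsup D C A \<delta> W u \<odot> w"
    and dsub_hom:
      "\<lbrakk>A \<in> Ob D; C \<in> Ob D; W \<in> Ob D; \<delta> \<in> carrier (Ext D C A)\<rbrakk>
        \<Longrightarrow> dsub D C A \<delta> W \<in> hom (NExt D A W) (Hom D C W)"
    and dsub_natural:
      "\<lbrakk>A \<in> Ob D; C \<in> Ob D; W \<in> Ob D; W' \<in> Ob D; \<delta> \<in> carrier (Ext D C A);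
        w \<in> Mor D W W'; u \<in> carrier (NExt D A W)\<rbrakk>
        \<Longrightarrow> dsub D C A \<delta> W' (NExtMap D (Idt D A) w u) = w \<odot> dsub D C A \<delta> W u"
    and exact_covariant:
      "\<lbrakk>etriangle D A B C x y \<delta>; W \<in> Ob D\<rbrakk> \<Longrightarrow>
        exact_at (NExt D W A) (NExtMap D (Idt D W) x) (NExt D W B)
                 (NExtMap D (Idt D W) y) (NExt D W C) \<and>
        exact_at (NExt D W B) (NExtMap D (Idt D W) y) (NExt D W C)
                 (dsup D C A \<delta> W) (Hom D W A) \<and>
        exact_at (NExt D W C) (dsup D C A \<delta> W) (Hom D W A) (\<lambda>f. x \<odot> f) (Hom D W B)"
    and exact_contravariant:
      "\<lbrakk>etriangle D A B C x y \<delta>; W \<in> Ob D\<rbrakk> \<Longrightarrow>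
        exact_at (NExt D C W) (NExtMap D y (Idt D W)) (NExt D B W)
                 (NExtMap D x (Idt D W)) (NExt D A W) \<and>
        exact_at (NExt D B W) (NExtMap D x (Idt D W)) (NExt D A W)
                 (dsub D C A \<delta> W) (Hom D C W) \<and>
        exact_at (NExt D A W) (dsub D C A \<delta> W) (Hom D C W) (\<lambda>f. f \<odot> y) (Hom D B W)"


section \<open>Torsion pairs and extended tilting objects\<close>

definition iso_closed :: "('o, 'm, 'z) add_cat_scheme \<Rightarrow> 'o set \<Rightarrow> bool"
  where "iso_closed D \<T> \<longleftrightarrow>
    (\<forall>X\<in>\<T>. \<forall>Y\<in>Ob D. \<forall>f. isomorphism D X Y f \<longrightarrow> Y \<in> \<T>)"

definition s_torsion_pair ::
    "('o, 'm, 'e, 'n, 'z) neg_extri_cat_scheme \<Rightarrow> 'o set \<Rightarrow> 'o set \<Rightarrow> bool"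
  where "s_torsion_pair D \<T> \<F> \<longleftrightarrow>
    \<T> \<subseteq> Ob D \<and> \<F> \<subseteq> Ob D \<and> iso_closed D \<T> \<and> iso_closed D \<F> \<and>
    (\<forall>T\<in>\<T>. \<forall>F\<in>\<F>. trivial_group (Hom D T F)) \<and>
    (\<forall>T\<in>\<T>. \<forall>F\<in>\<F>. trivial_group (NExt D T F)) \<and>
    (\<forall>X\<in>Ob D. \<exists>T\<in>\<T>. \<exists>F\<in>\<F>. \<exists>x y. conflation D T X F x y)"

definition perp0 :: "('o, 'm, 'z) add_cat_scheme \<Rightarrow> 'o \<Rightarrow> 'o set"
  where "perp0 D V = {X \<in> Ob D. trivial_group (Hom D V X)}"

definition perp1 :: "('o, 'm, 'e, 'z) extri_cat_scheme \<Rightarrow> 'o \<Rightarrow> 'o set"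
  where "perp1 D V = {X \<in> Ob D. trivial_group (Ext D V X)}"

definition is_copower ::
    "('o, 'm, 'z) add_cat_scheme \<Rightarrow> 'o \<Rightarrow> 'i set \<Rightarrow> 'o \<Rightarrow> ('i \<Rightarrow> 'm) \<Rightarrow> bool"
  where "is_copower D V \<alpha> Q \<iota> \<longleftrightarrow> Q \<in> Ob D \<and> (\<forall>i\<in>\<alpha>. \<iota> i \<in> Mor D V Q) \<and>
    (\<forall>Y\<in>Ob D. \<forall>g. (\<forall>i\<in>\<alpha>. g i \<in> Mor D V Y) \<longrightarrow>
      (\<exists>!h. h \<in> Mor D Q Y \<and> (\<forall>i\<in>\<alpha>. h \<odot>\<^bsub>D\<^esub> \<iota> i = g i)))"

text \<open>
  In the next two definitions the index set ranges over sets of morphisms, which loses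
  nothing: if \<open>V \<noteq> 0\<close> the injections of a coproduct of copies of \<open>V\<close> are pairwise distinct
  and can serve as indices, and if \<open>V = 0\<close> the coproduct is \<open>0\<close> and there is no \<open>f \<noteq> 0\<close>.
\<close>

definition Gen :: "('o, 'm, 'e, 'z) extri_cat_scheme \<Rightarrow> 'o \<Rightarrow> 'o set"
  where "Gen D V = {X \<in> Ob D. zero_object D X \<or>
    (\<exists>(\<alpha> :: 'm set) \<iota> Q A x f. is_copower D V \<alpha> Q \<iota> \<and> conflation D A Q X x f \<and>
       f \<noteq> \<one>\<^bsub>Hom D Q X\<^esub>)}"

definition Pres :: "('o, 'm, 'e, 'z) extri_cat_scheme \<Rightarrow> 'o \<Rightarrow> 'o set"
  where "Pres D V = {X \<in> Ob D. zero_object D X \<or>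
    (\<exists>(\<alpha> :: 'm set) \<iota> Q A x f. is_copower D V \<alpha> Q \<iota> \<and> conflation D A Q X x f \<and>
       f \<noteq> \<one>\<^bsub>Hom D Q X\<^esub> \<and> A \<in> Gen D V)}"

definition cogenerating :: "('o, 'm, 'e, 'z) extri_cat_scheme \<Rightarrow> 'o set \<Rightarrow> bool"
  where "cogenerating D \<S> \<longleftrightarrow>
    (\<forall>X\<in>Ob D. \<exists>S\<in>\<S>. \<exists>X' x y. conflation D X S X' x y)"

definition extended_tilting :: "('o, 'm, 'e, 'n, 'z) neg_extri_cat_scheme \<Rightarrow> 'o \<Rightarrow> bool"
  where "extended_tilting D V \<longleftrightarrow> V \<in> Ob D \<and>
    s_torsion_pair D (Gen D V) (perp0 D V) \<and>
    Gen D V = Pres D V \<and> Gen D V \<subseteq> perp1 D V \<and>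
    cogenerating D (Gen D V)"


section \<open>Higher extensions and projective dimension\<close>

text \<open>
  Elements of \<open>\<E>\<^sup>n\<^sup>+\<^sup>1(A, B)\<close> are iterated quotients whose types would grow with \<open>n\<close>.  They are
  therefore represented by iterated pairs: \<open>Single \<delta>\<close> stands for \<open>\<delta> \<in> \<E>(A, B)\<close>, and
  \<open>Splice C \<delta> w\<close> stands for the class of \<open>(\<delta>, \<eta>)\<close> with \<open>\<delta> \<in> \<E>(C, B)\<close> and \<open>\<eta>\<close> represented by \<open>w\<close>.
  All indices are shifted by one: \<open>n\<close> refers to \<open>\<E>\<^sup>n\<^sup>+\<^sup>1\<close>.
\<close>

datatype ('o, 'e) hext_word = Single 'e | Splice 'o 'e "('o, 'e) hext_word"

primrec hext_words ::
    "('o, 'm, 'e, 'z) extri_cat_scheme \<Rightarrow> nat \<Rightarrow> 'o \<Rightarrow> 'o \<Rightarrow> ('o, 'e) hext_word set"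
  where
    "hext_words D 0 A B = Single ` carrier (Ext D A B)"
  | "hext_words D (Suc n) A B =
      {Splice C \<delta> w | C \<delta> w. C \<in> Ob D \<and> \<delta> \<in> carrier (Ext D C B) \<and> w \<in> hext_words D n A C}"

text \<open>The action \<open>\<beta> \<cdot> w\<close> of a morphism \<open>\<beta>\<close> on a word \<open>w\<close> over \<open>\<E>\<^sup>n\<^sup>+\<^sup>1(A, -)\<close>.\<close>

primrec word_push ::
    "('o, 'm, 'e, 'z) extri_cat_scheme \<Rightarrow> 'o \<Rightarrow> 'm \<Rightarrow> ('o, 'e) hext_word \<Rightarrow> ('o, 'e) hext_word"
  where
    "word_push D A \<beta> (Single \<delta>) = Single (push D A \<beta> \<delta>)"
  | "word_push D A \<beta> (Splice C \<delta> w) = Splice C (push D C \<beta> \<delta>) w"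

lemma size_word_push [simp]: "size (word_push D A \<beta> w) = size w"
  by (cases w) auto

text \<open>
  Equality of the represented elements of \<open>\<E>\<^sup>n\<^sup>+\<^sup>1(A, B)\<close>: \<open>slide\<close> is the generating
  identification \<open>(\<delta> \<cdot> f, \<eta>) \<sim> (\<delta>, f \<cdot> \<eta>)\<close>, and \<open>splice\<close> makes the second component of a pair a
  class of words instead of a word.
\<close>

inductive hext_equiv ::
    "('o, 'm, 'e, 'z) extri_cat_scheme \<Rightarrow> nat \<Rightarrow> 'o \<Rightarrow> 'o \<Rightarrow>
     ('o, 'e) hext_word \<Rightarrow> ('o, 'e) hext_word \<Rightarrow> bool"
  for D
  where
    refl: "w \<in> hext_words D n A B \<Longrightarrow> hext_equiv D n A B w w"
  | sym: "hext_equiv D n A B w w' \<Longrightarrow> hext_equiv D n A B w' w"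
  | trans: "\<lbrakk>hext_equiv D n A B w w'; hext_equiv D n A B w' w''\<rbrakk> \<Longrightarrow> hext_equiv D n A B w w''"
  | splice: "\<lbrakk>C \<in> Ob D; \<delta> \<in> carrier (Ext D C B); hext_equiv D n A C w w'\<rbrakk>
      \<Longrightarrow> hext_equiv D (Suc n) A B (Splice C \<delta> w) (Splice C \<delta> w')"
  | slide: "\<lbrakk>X \<in> Ob D; Y \<in> Ob D; f \<in> Mor D X Y; \<delta> \<in> carrier (Ext D Y B);
        w \<in> hext_words D n A X\<rbrakk>
      \<Longrightarrow> hext_equiv D (Suc n) A B (Splice X (pull D B \<delta> f) w) (Splice Y \<delta> (word_push D A f w))"

definition biproduct :: "('o, 'm, 'z) add_cat_scheme \<Rightarrow> 'o \<Rightarrow> 'o \<Rightarrow> 'o \<times> 'm \<times> 'm \<times> 'm \<times> 'm"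
  where "biproduct D A B = (SOME b. is_biproduct D A B b)"

fun word_add ::
    "('o, 'm, 'e, 'z) extri_cat_scheme \<Rightarrow> 'o \<Rightarrow> 'o \<Rightarrow>
     ('o, 'e) hext_word \<Rightarrow> ('o, 'e) hext_word \<Rightarrow> ('o, 'e) hext_word"
  where
    "word_add D A B (Single \<delta>) (Single \<delta>') = Single (\<delta> \<otimes>\<^bsub>Ext D A B\<^esub> \<delta>')"
  | "word_add D A B (Splice X \<delta> w) (Splice Y \<delta>' w') =
      (case biproduct D X Y of (S, m1, m2, p1, p2) \<Rightarrow>
        Splice S (pull D B \<delta> p1 \<otimes>\<^bsub>Ext D S B\<^esub> pull D B \<delta>' p2)
          (word_add D A S (word_push D A m1 w) (word_push D A m2 w')))"
  | "word_add D A B _ _ = undefined"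

primrec word_zero ::
    "('o, 'm, 'e, 'z) extri_cat_scheme \<Rightarrow> nat \<Rightarrow> 'o \<Rightarrow> 'o \<Rightarrow> ('o, 'e) hext_word"
  where
    "word_zero D 0 A B = Single \<one>\<^bsub>Ext D A B\<^esub>"
  | "word_zero D (Suc n) A B = Splice B \<one>\<^bsub>Ext D B B\<^esub> (word_zero D n A B)"

definition hext_rel ::
    "('o, 'm, 'e, 'z) extri_cat_scheme \<Rightarrow> nat \<Rightarrow> 'o \<Rightarrow> 'o \<Rightarrow>
     (('o, 'e) hext_word \<times> ('o, 'e) hext_word) set"
  where "hext_rel D n A B = {(w, w'). hext_equiv D n A B w w'}"

text \<open>The group \<open>\<E>\<^sup>n\<^sup>+\<^sup>1(A, B)\<close> with the Baer sum.\<close>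

definition hext ::
    "('o, 'm, 'e, 'z) extri_cat_scheme \<Rightarrow> nat \<Rightarrow> 'o \<Rightarrow> 'o \<Rightarrow> ('o, 'e) hext_word set monoid"
  where "hext D n A B = \<lparr>
    carrier = hext_words D n A B // hext_rel D n A B,
    mult = (\<lambda>P Q. \<Union>w\<in>P. \<Union>w'\<in>Q. hext_rel D n A B `` {word_add D A B w w'}),
    one = hext_rel D n A B `` {word_zero D n A B}\<rparr>"

text \<open>\<open>\<E>\<^sup>k\<^sup>+\<^sup>1(V, -) = 0\<close>, in view of the index shift.\<close>

definition hext_vanishes :: "('o, 'm, 'e, 'z) extri_cat_scheme \<Rightarrow> 'o \<Rightarrow> nat \<Rightarrow> bool"
  where "hext_vanishes D V k \<longleftrightarrow> (\<forall>B\<in>Ob D. trivial_group (hext D k V B))"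

definition pd :: "('o, 'm, 'e, 'z) extri_cat_scheme \<Rightarrow> 'o \<Rightarrow> enat"
  where "pd D V =
    (if \<exists>k. hext_vanishes D V k then enat (LEAST k. hext_vanishes D V k) else \<infinity>)"


section \<open>Exact categories\<close>

definition is_kernel ::
    "('o, 'm, 'z) add_cat_scheme \<Rightarrow> 'o \<Rightarrow> 'o \<Rightarrow> 'o \<Rightarrow> 'm \<Rightarrow> 'm \<Rightarrow> bool"
  where "is_kernel D A B C x y \<longleftrightarrow> x \<in> Mor D A B \<and> y \<odot>\<^bsub>D\<^esub> x = \<one>\<^bsub>Hom D A C\<^esub> \<and>
    (\<forall>W\<in>Ob D. \<forall>g\<in>Mor D W B. y \<odot>\<^bsub>D\<^esub> g = \<one>\<^bsub>Hom D W C\<^esub> \<longrightarrow>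
      (\<exists>!h. h \<in> Mor D W A \<and> x \<odot>\<^bsub>D\<^esub> h = g))"

definition is_cokernel ::
    "('o, 'm, 'z) add_cat_scheme \<Rightarrow> 'o \<Rightarrow> 'o \<Rightarrow> 'o \<Rightarrow> 'm \<Rightarrow> 'm \<Rightarrow> bool"
  where "is_cokernel D A B C x y \<longleftrightarrow> y \<in> Mor D B C \<and> y \<odot>\<^bsub>D\<^esub> x = \<one>\<^bsub>Hom D A C\<^esub> \<and>
    (\<forall>W\<in>Ob D. \<forall>g\<in>Mor D B W. g \<odot>\<^bsub>D\<^esub> x = \<one>\<^bsub>Hom D A W\<^esub> \<longrightarrow>
      (\<exists>!h. h \<in> Mor D C W \<and> h \<odot>\<^bsub>D\<^esub> y = g))"

definition is_pushout ::
    "('o, 'm, 'z) add_cat_scheme \<Rightarrow> 'o \<Rightarrow> 'o \<Rightarrow> 'o \<Rightarrow> 'o \<Rightarrow> 'm \<Rightarrow> 'm \<Rightarrow> 'm \<Rightarrow> 'm \<Rightarrow> bool"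
  where "is_pushout D A B A' P x a x' b \<longleftrightarrow>
    P \<in> Ob D \<and> x' \<in> Mor D A' P \<and> b \<in> Mor D B P \<and> b \<odot>\<^bsub>D\<^esub> x = x' \<odot>\<^bsub>D\<^esub> a \<and>
    (\<forall>W\<in>Ob D. \<forall>u\<in>Mor D B W. \<forall>v\<in>Mor D A' W. u \<odot>\<^bsub>D\<^esub> x = v \<odot>\<^bsub>D\<^esub> a \<longrightarrow>
      (\<exists>!h. h \<in> Mor D P W \<and> h \<odot>\<^bsub>D\<^esub> b = u \<and> h \<odot>\<^bsub>D\<^esub> x' = v))"

definition is_pullback ::
    "('o, 'm, 'z) add_cat_scheme \<Rightarrow> 'o \<Rightarrow> 'o \<Rightarrow> 'o \<Rightarrow> 'o \<Rightarrow> 'm \<Rightarrow> 'm \<Rightarrow> 'm \<Rightarrow> 'm \<Rightarrow> bool"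
  where "is_pullback D B C C' P y c y' b \<longleftrightarrow>
    P \<in> Ob D \<and> y' \<in> Mor D P C' \<and> b \<in> Mor D P B \<and> y \<odot>\<^bsub>D\<^esub> b = c \<odot>\<^bsub>D\<^esub> y' \<and>
    (\<forall>W\<in>Ob D. \<forall>u\<in>Mor D W B. \<forall>v\<in>Mor D W C'. y \<odot>\<^bsub>D\<^esub> u = c \<odot>\<^bsub>D\<^esub> v \<longrightarrow>
      (\<exists>!h. h \<in> Mor D W P \<and> b \<odot>\<^bsub>D\<^esub> h = u \<and> y' \<odot>\<^bsub>D\<^esub> h = v))"

definition inflation :: "('o, 'm, 'e, 'z) extri_cat_scheme \<Rightarrow> 'o \<Rightarrow> 'o \<Rightarrow> 'm \<Rightarrow> bool"
  where "inflation D A B x \<longleftrightarrow> (\<exists>C y. conflation D A B C x y)"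

definition deflation :: "('o, 'm, 'e, 'z) extri_cat_scheme \<Rightarrow> 'o \<Rightarrow> 'o \<Rightarrow> 'm \<Rightarrow> bool"
  where "deflation D B C y \<longleftrightarrow> (\<exists>A x. conflation D A B C x y)"

text \<open>
  \<open>D\<close> is an exact category in the sense of Quillen, regarded as an extriangulated category:
  the conflations are an exact structure (Buehler's axioms), \<open>\<E>(C, A)\<close> is the
  set of equivalence classes of conflations \<open>A \<rightarrow> B \<rightarrow> C\<close>, and \<open>\<E>\<^sup>-\<^sup>1 = 0\<close>.  That \<open>\<E>\<close> acts by
  pushout, pullback and Baer sum is then a consequence of the axioms for \<open>\<ss>\<close>.
\<close>

definition exact_category :: "('o, 'm, 'e, 'n, 'z) neg_extri_cat_scheme \<Rightarrow> bool"
  where "exact_category D \<longleftrightarrow>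
    (\<forall>A B C x y. conflation D A B C x y \<longrightarrow>
       is_kernel D A B C x y \<and> is_cokernel D A B C x y) \<and>
    (\<forall>A B C x y A' B' C' x' y' a b c.
       conflation D A B C x y \<and> A' \<in> Ob D \<and> B' \<in> Ob D \<and> C' \<in> Ob D \<and>
       x' \<in> Mor D A' B' \<and> y' \<in> Mor D B' C' \<and>
       isomorphism D A A' a \<and> isomorphism D B B' b \<and> isomorphism D C C' c \<and>
       b \<odot>\<^bsub>D\<^esub> x = x' \<odot>\<^bsub>D\<^esub> a \<and> c \<odot>\<^bsub>D\<^esub> y = y' \<odot>\<^bsub>D\<^esub> b \<longrightarrow> conflation D A' B' C' x' y') \<and>
    (\<forall>A\<in>Ob D. inflation D A A (Idt D A) \<and> deflation D A A (Idt D A)) \<and>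
    (\<forall>A B C f g. inflation D A B f \<and> inflation D B C g \<longrightarrow> inflation D A C (g \<odot>\<^bsub>D\<^esub> f)) \<and>
    (\<forall>A B C f g. deflation D A B f \<and> deflation D B C g \<longrightarrow> deflation D A C (g \<odot>\<^bsub>D\<^esub> f)) \<and>
    (\<forall>A B x A' a. inflation D A B x \<and> A' \<in> Ob D \<and> a \<in> Mor D A A' \<longrightarrow>
       (\<exists>P x' b. is_pushout D A B A' P x a x' b \<and> inflation D A' P x')) \<and>
    (\<forall>B C y C' c. deflation D B C y \<and> C' \<in> Ob D \<and> c \<in> Mor D C' C \<longrightarrow>
       (\<exists>P y' b. is_pullback D B C C' P y c y' b \<and> deflation D P C' y')) \<and>
    (\<forall>A\<in>Ob D. \<forall>C\<in>Ob D. inj_on (Rlz D C A) (carrier (Ext D C A))) \<and>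
    (\<forall>A\<in>Ob D. \<forall>C\<in>Ob D. trivial_group (NExt D C A))"

end

theory Submission
  imports Defs
begin

text \<open>
  For \<open>S \<in> Gen V\<close> the group \<open>\<E>\<^sup>2(V, S)\<close> vanishes without further hypotheses: if \<open>\<delta> \<in> \<E>(C, S)\<close>, then
  \<open>\<delta>\<close> is pulled back along some \<open>C \<rightarrow> W\<close> from an extension \<open>S \<rightarrow> S' \<rightarrow> W\<close> with \<open>S' \<in> Gen V\<close>, and
  \<open>\<E>\<^sup>-\<^sup>1(S, \<F>) = 0\<close> forces \<open>Hom(W, \<F>) = 0\<close>, hence \<open>\<E>(V, W) = 0\<close>.  By dimension shifting,
  \<open>\<E>\<^sup>2(V, B) = 0\<close> whenever \<open>B \<rightarrow> M \<rightarrow> Y\<close> is a conflation with \<open>\<E>\<^sup>2(V, M) = 0 = \<E>(V, Y)\<close>.  This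
  reduces the claim to the objects of \<open>\<F> \<inter> V\<^sup>\<bottom>\<^sup>1\<close>, and each of (a), (b), (c) embeds these into
  \<open>Gen V\<close> with cokernel in \<open>V\<^sup>\<bottom>\<^sup>1\<close>.
\<close>

section \<open>Exact sequences in extriangulated categories\<close>

context additive_category
begin

lemma group_Hom [simp]: "\<lbrakk>A \<in> Ob D; B \<in> Ob D\<rbrakk> \<Longrightarrow> group (Hom D A B)"
  using Hom_comm_group comm_group.axioms(2) by blast

lemma zero_Mor [simp]: "\<lbrakk>A \<in> Ob D; B \<in> Ob D\<rbrakk> \<Longrightarrow> \<one>\<^bsub>Hom D A B\<^esub> \<in> Mor D A B"
  using group_Hom group.is_monoid monoid.one_closed by blast

lemma precompose_hom:
  assumes "A \<in> Ob D" "B \<in> Ob D" "C \<in> Ob D" "f \<in> Mor D A B"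
  shows "(\<lambda>g. g \<odot> f) \<in> hom (Hom D B C) (Hom D A C)"
  using assms by (intro homI) (auto simp: Cmp_closed Cmp_add_left)

lemma postcompose_hom:
  assumes "A \<in> Ob D" "B \<in> Ob D" "C \<in> Ob D" "g \<in> Mor D B C"
  shows "(\<lambda>f. g \<odot> f) \<in> hom (Hom D A B) (Hom D A C)"
  using assms by (intro homI) (auto simp: Cmp_closed Cmp_add_right)

lemma Cmp_zero_left:
  assumes "A \<in> Ob D" "B \<in> Ob D" "C \<in> Ob D" "f \<in> Mor D A B"
  shows "\<one>\<^bsub>Hom D B C\<^esub> \<odot> f = \<one>\<^bsub>Hom D A C\<^esub>"
  using hom_one[OF precompose_hom[OF assms]] assms by simp

lemma Cmp_zero_right:
  assumes "A \<in> Ob D" "B \<in> Ob D" "C \<in> Ob D" "g \<in> Mor D B C"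
  shows "g \<odot> \<one>\<^bsub>Hom D A B\<^esub> = \<one>\<^bsub>Hom D A C\<^esub>"
  using hom_one[OF postcompose_hom[OF assms]] assms by simp

lemma trivial_Hom_zero:
  assumes "trivial_group (Hom D A B)" "f \<in> Mor D A B"
  shows "f = \<one>\<^bsub>Hom D A B\<^esub>"
  using assms by (auto simp: trivial_group_def)

lemma zero_objectI:
  assumes "A \<in> Ob D" "Idt D A = \<one>\<^bsub>Hom D A A\<^esub>"
  shows "zero_object D A"
proof -
  have "f = \<one>\<^bsub>Hom D A X\<^esub>" if "X \<in> Ob D" "f \<in> Mor D A X" for X f
    using Cmp_Idt_right[of A X f] Cmp_zero_right[of A A X f] assms that by simp
  moreover have "f = \<one>\<^bsub>Hom D X A\<^esub>" if "X \<in> Ob D" "f \<in> Mor D X A" for X f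
    using Cmp_Idt_left[of X A f] Cmp_zero_left[of X A A f] assms that by simp
  ultimately show ?thesis
    using assms(1) by (auto simp: zero_object_def trivial_group_def)
qed

lemma biproduct_zero_left:
  assumes "zero_object D Z" "W \<in> Ob D"
  shows "is_biproduct D Z W (W, \<one>\<^bsub>Hom D Z W\<^esub>, Idt D W, \<one>\<^bsub>Hom D W Z\<^esub>, Idt D W)"
proof -
  have Z: "Z \<in> Ob D" using assms(1) by (simp add: zero_object_def)
  have id: "Idt D Z = \<one>\<^bsub>Hom D Z Z\<^esub>"
    using assms(1) Z Idt_closed trivial_Hom_zero by (simp add: zero_object_def)
  show ?thesis
    using Z assms(2) id group.is_monoid[OF group_Hom]
    by (simp add: is_biproduct_def Idt_closed Cmp_zero_left[of _ Z] Cmp_zero_right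
        Cmp_Idt_left Cmp_Idt_right monoid.l_one)
qed

lemma biproduct_zero_right:
  assumes "zero_object D Z" "W \<in> Ob D"
  shows "is_biproduct D W Z (W, Idt D W, \<one>\<^bsub>Hom D Z W\<^esub>, Idt D W, \<one>\<^bsub>Hom D W Z\<^esub>)"
proof -
  have Z: "Z \<in> Ob D" using assms(1) by (simp add: zero_object_def)
  have id: "Idt D Z = \<one>\<^bsub>Hom D Z Z\<^esub>"
    using assms(1) Z Idt_closed trivial_Hom_zero by (simp add: zero_object_def)
  show ?thesis
    using Z assms(2) id group.is_monoid[OF group_Hom]
    by (simp add: is_biproduct_def Idt_closed Cmp_zero_left[of _ Z] Cmp_zero_right
        Cmp_Idt_left Cmp_Idt_right monoid.r_one)
qed

lemma is_biproduct_biproduct: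
  "\<lbrakk>A \<in> Ob D; B \<in> Ob D\<rbrakk> \<Longrightarrow> is_biproduct D A B (biproduct D A B)"
  unfolding biproduct_def by (rule someI_ex) (rule biproduct_exists)

end

lemma etriangleD:
  assumes "etriangle D A B C x y \<delta>"
  shows "A \<in> Ob D" "B \<in> Ob D" "C \<in> Ob D" "x \<in> Mor D A B" "y \<in> Mor D B C"
    "\<delta> \<in> carrier (Ext D C A)"
  using assms by (auto simp: etriangle_def)

section \<open>The actions of morphisms on extension groups\<close>

context extriangulated_category
begin

lemma group_Ext [simp]: "\<lbrakk>C \<in> Ob D; A \<in> Ob D\<rbrakk> \<Longrightarrow> group (Ext D C A)"
  using F_comm_group comm_group.axioms(2) by blast

lemma zero_Ext [simp]: "\<lbrakk>C \<in> Ob D; A \<in> Ob D\<rbrakk> \<Longrightarrow> \<one>\<^bsub>Ext D C A\<^esub> \<in> carrier (Ext D C A)"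
  using group_Ext group.is_monoid monoid.one_closed by blast

lemma trivial_ExtI:
  assumes "C \<in> Ob D" "A \<in> Ob D" "\<And>\<delta>. \<delta> \<in> carrier (Ext D C A) \<Longrightarrow> \<delta> = \<one>\<^bsub>Ext D C A\<^esub>"
  shows "trivial_group (Ext D C A)"
  using assms zero_Ext[of C A] unfolding trivial_group_def by auto

lemma pull_hom:
  assumes "C \<in> Ob D" "C' \<in> Ob D" "A \<in> Ob D" "c \<in> Mor D C' C"
  shows "(\<lambda>\<delta>. pull D A \<delta> c) \<in> hom (Ext D C A) (Ext D C' A)"
  unfolding pull_def using Fm_hom[of C C' A A c "Idt D A"] assms Idt_closed by simp

lemma push_hom:
  assumes "C \<in> Ob D" "A \<in> Ob D" "A' \<in> Ob D" "a \<in> Mor D A A'"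
  shows "push D C a \<in> hom (Ext D C A) (Ext D C A')"
  unfolding push_def using Fm_hom[of C C A A' "Idt D C" a] assms Idt_closed by simp

lemma pull_closed:
  assumes "C \<in> Ob D" "C' \<in> Ob D" "A \<in> Ob D" "c \<in> Mor D C' C" "\<delta> \<in> carrier (Ext D C A)"
  shows "pull D A \<delta> c \<in> carrier (Ext D C' A)"
  using hom_in_carrier[OF pull_hom] assms by blast

lemma push_closed:
  assumes "C \<in> Ob D" "A \<in> Ob D" "A' \<in> Ob D" "a \<in> Mor D A A'" "\<delta> \<in> carrier (Ext D C A)"
  shows "push D C a \<delta> \<in> carrier (Ext D C A')"
  using hom_in_carrier[OF push_hom] assms by blast

lemma pull_one:
  assumes "C \<in> Ob D" "C' \<in> Ob D" "A \<in> Ob D" "c \<in> Mor D C' C"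
  shows "pull D A \<one>\<^bsub>Ext D C A\<^esub> c = \<one>\<^bsub>Ext D C' A\<^esub>"
  using hom_one[OF pull_hom[OF assms]] assms by simp

lemma push_one:
  assumes "C \<in> Ob D" "A \<in> Ob D" "A' \<in> Ob D" "a \<in> Mor D A A'"
  shows "push D C a \<one>\<^bsub>Ext D C A\<^esub> = \<one>\<^bsub>Ext D C A'\<^esub>"
  using hom_one[OF push_hom[OF assms]] assms by simp

lemma pull_Idt:
  "\<lbrakk>C \<in> Ob D; A \<in> Ob D; \<delta> \<in> carrier (Ext D C A)\<rbrakk> \<Longrightarrow> pull D A \<delta> (Idt D C) = \<delta>"
  unfolding pull_def by (rule Fm_Idt)

lemma push_Idt:
  "\<lbrakk>C \<in> Ob D; A \<in> Ob D; \<delta> \<in> carrier (Ext D C A)\<rbrakk> \<Longrightarrow> push D C (Idt D A) \<delta> = \<delta>"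
  unfolding push_def by (rule Fm_Idt)

lemma pull_pull:
  assumes "C \<in> Ob D" "C' \<in> Ob D" "C'' \<in> Ob D" "A \<in> Ob D"
    "c \<in> Mor D C' C" "c' \<in> Mor D C'' C'" "\<delta> \<in> carrier (Ext D C A)"
  shows "pull D A (pull D A \<delta> c) c' = pull D A \<delta> (c \<odot> c')"
  unfolding pull_def
  using Fm_Cmp[of C C' C'' A A A c c' "Idt D A" "Idt D A" \<delta>] assms
  by (simp add: Idt_closed Cmp_Idt_left[of A A])

lemma push_push:
  assumes "C \<in> Ob D" "A \<in> Ob D" "A' \<in> Ob D" "A'' \<in> Ob D"
    "a \<in> Mor D A A'" "a' \<in> Mor D A' A''" "\<delta> \<in> carrier (Ext D C A)"
  shows "push D C a' (push D C a \<delta>) = push D C (a' \<odot> a) \<delta>"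
  unfolding push_def
  using Fm_Cmp[of C C C A A' A'' "Idt D C" "Idt D C" a a' \<delta>] assms
  by (simp add: Idt_closed Cmp_Idt_left[of C C])

lemma push_pull:
  assumes "C \<in> Ob D" "C' \<in> Ob D" "A \<in> Ob D" "A' \<in> Ob D"
    "c \<in> Mor D C' C" "a \<in> Mor D A A'" "\<delta> \<in> carrier (Ext D C A)"
  shows "push D C' a (pull D A \<delta> c) = pull D A' (push D C a \<delta>) c"
proof -
  have "push D C' a (pull D A \<delta> c) = ExtMap D (c \<odot> Idt D C') (a \<odot> Idt D A) \<delta>"
    unfolding push_def pull_def
    using Fm_Cmp[of C C' C' A A A' c "Idt D C'" "Idt D A" a \<delta>] assms Idt_closed by simp
  also have "\<dots> = ExtMap D (Idt D C \<odot> c) (Idt D A' \<odot> a) \<delta>"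
    using assms by (simp add: Cmp_Idt_left[of C' C c] Cmp_Idt_right[of C' C c]
        Cmp_Idt_left[of A A' a] Cmp_Idt_right[of A A' a])
  also have "\<dots> = pull D A' (push D C a \<delta>) c"
    unfolding push_def pull_def
    using Fm_Cmp[of C C C' A A' A' "Idt D C" c a "Idt D A'" \<delta>] assms Idt_closed by simp
  finally show ?thesis .
qed

lemma pull_zero:
  assumes "C \<in> Ob D" "C' \<in> Ob D" "A \<in> Ob D" "\<delta> \<in> carrier (Ext D C A)"
  shows "pull D A \<delta> \<one>\<^bsub>Hom D C' C\<^esub> = \<one>\<^bsub>Ext D C' A\<^esub>"
proof -
  have "(\<lambda>c. pull D A \<delta> c) \<in> hom (Hom D C' C) (Ext D C' A)"
    using assms Fm_add_left[of C C' A A _ _ "Idt D A" \<delta>] pull_closed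
    by (intro homI) (auto simp: pull_def Idt_closed)
  from hom_one[OF this] show ?thesis using assms by simp
qed

lemma push_add:
  assumes "C \<in> Ob D" "A \<in> Ob D" "A' \<in> Ob D" "a \<in> Mor D A A'" "a' \<in> Mor D A A'"
    "\<delta> \<in> carrier (Ext D C A)"
  shows "push D C (a \<otimes>\<^bsub>Hom D A A'\<^esub> a') \<delta> = push D C a \<delta> \<otimes>\<^bsub>Ext D C A'\<^esub> push D C a' \<delta>"
  using assms Fm_add_right[of C C A A' "Idt D C" a a' \<delta>] by (simp add: push_def Idt_closed)

lemma push_zero:
  assumes "C \<in> Ob D" "A \<in> Ob D" "A' \<in> Ob D" "\<delta> \<in> carrier (Ext D C A)"
  shows "push D C \<one>\<^bsub>Hom D A A'\<^esub> \<delta> = \<one>\<^bsub>Ext D C A'\<^esub>"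
proof -
  have "(\<lambda>a. push D C a \<delta>) \<in> hom (Hom D A A') (Ext D C A')"
    using assms by (intro homI) (auto simp: push_add push_closed)
  from hom_one[OF this] show ?thesis using assms by simp
qed

lemma etriangle_exists:
  assumes "A \<in> Ob D" "C \<in> Ob D" "\<delta> \<in> carrier (Ext D C A)"
  obtains B x y where "etriangle D A B C x y \<delta>"
proof -
  obtain B x y where s: "(B, x, y) \<in> seqs D A C"
    and R: "Rlz D C A \<delta> = seq_equiv D A C `` {(B, x, y)}"
    using Rlz_class[OF assms] unfolding quotient_def by auto
  then have B: "B \<in> Ob D" and x: "x \<in> Mor D A B" and y: "y \<in> Mor D B C"
    by (auto simp: seqs_def)
  \<comment> \<open>Reflexivity of \<open>seq_equiv\<close>, witnessed by the identity, puts the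
    representative into its own class.\<close>
  have "isomorphism D B B (Idt D B)"
    using B by (auto simp: isomorphism_def Idt_closed Cmp_Idt_left[of B B] intro!: bexI[of _ "Idt D B"])
  then have "(B, x, y) \<in> Rlz D C A \<delta>"
    using s B x y assms Cmp_Idt_left[of A B x] Cmp_Idt_right[of B C y]
    unfolding R seq_equiv_def by auto
  then show thesis using that B x y assms by (auto simp: etriangle_def)
qed

text \<open>The split conflations \<open>0 -> W -> W\<close> and \<open>W -> W -> 0\<close> are test
  objects: comparing a conflation with them turns \<open>ET3\<close> and \<open>ET3_op\<close> into
  statements on composition and factorization.\<close>

lemma etriangle_zero_left:
  assumes "zero_object D Z" "W \<in> Ob D"
  shows "etriangle D Z W W \<one>\<^bsub>Hom D Z W\<^esub> (Idt D W) \<one>\<^bsub>Ext D W Z\<^esub>"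
  using assms Rlz_zero[OF _ _ biproduct_zero_left[OF assms]]
  by (auto simp: etriangle_def zero_object_def Idt_closed)

lemma etriangle_zero_right:
  assumes "zero_object D Z" "W \<in> Ob D"
  shows "etriangle D W W Z (Idt D W) \<one>\<^bsub>Hom D W Z\<^esub> \<one>\<^bsub>Ext D Z W\<^esub>"
  using assms Rlz_zero[OF _ _ biproduct_zero_right[OF assms]]
  by (auto simp: etriangle_def zero_object_def Idt_closed)

text \<open>The identity of \<open>A\<close> and \<open>x\<close> map \<open>A -> A -> 0\<close> to
  the conflation, so \<open>ET3\<close> factors \<open>y \<odot> x\<close> through zero.\<close>

lemma etriangle_Cmp_zero:
  assumes T: "etriangle D A B C x y \<delta>"
  shows "y \<odot> x = \<one>\<^bsub>Hom D A C\<^esub>"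
proof -
  note t = etriangleD[OF T]
  obtain Z where Z: "zero_object D Z" using zero_object_exists by blast
  then have Zo: "Z \<in> Ob D" by (simp add: zero_object_def)
  obtain c where c: "c \<in> Mor D Z C" "c \<odot> \<one>\<^bsub>Hom D A Z\<^esub> = y \<odot> x"
    using ET3[OF etriangle_zero_right[OF Z t(1)] T Idt_closed[OF t(1)] t(4)] by auto
  then show ?thesis using Cmp_zero_right[of A Z C c] t Zo by simp
qed

lemma etriangle_push_zero:
  assumes T: "etriangle D A B C x y \<delta>"
  shows "push D C x \<delta> = \<one>\<^bsub>Ext D C B\<^esub>"
proof -
  note t = etriangleD[OF T]
  obtain Z where Z: "zero_object D Z" using zero_object_exists by blast
  then have Zo: "Z \<in> Ob D" by (simp add: zero_object_def)
  obtain c where c: "c \<in> Mor D C Z" "push D C x \<delta> = pull D B \<one>\<^bsub>Ext D Z B\<^esub> c"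
    using ET3[OF T etriangle_zero_right[OF Z t(2)] t(4) Idt_closed[OF t(2)]] by auto
  then show ?thesis using pull_one[of Z C B c] t Zo by simp
qed

lemma etriangle_pull_zero:
  assumes T: "etriangle D A B C x y \<delta>"
  shows "pull D A \<delta> y = \<one>\<^bsub>Ext D B A\<^esub>"
proof -
  note t = etriangleD[OF T]
  obtain Z where Z: "zero_object D Z" using zero_object_exists by blast
  then have Zo: "Z \<in> Ob D" by (simp add: zero_object_def)
  obtain a where a: "a \<in> Mor D Z A" "push D B a \<one>\<^bsub>Ext D B Z\<^esub> = pull D A \<delta> y"
    using ET3_op[OF etriangle_zero_left[OF Z t(2)] T Idt_closed[OF t(2)] t(5)] by auto
  then show ?thesis using push_one[of B Z A a] t Zo by simp
qed

section \<open>Factorization through conflations and exactness of the Hom-Ext sequences\<close>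

lemma factor_through_deflation:
  assumes T: "etriangle D A B C x y \<delta>" and W: "W \<in> Ob D"
    and f: "f \<in> Mor D B W" "f \<odot> x = \<one>\<^bsub>Hom D A W\<^esub>"
  obtains g where "g \<in> Mor D C W" "g \<odot> y = f"
proof -
  note t = etriangleD[OF T]
  obtain Z where Z: "zero_object D Z" using zero_object_exists by blast
  then have Zo: "Z \<in> Ob D" by (simp add: zero_object_def)
  \<comment> \<open>\<open>f\<close> and the zero map form a square into \<open>0 -> W -> W\<close>;
    the third component supplied by \<open>ET3\<close> is the factorization.\<close>
  have "f \<odot> x = \<one>\<^bsub>Hom D Z W\<^esub> \<odot> \<one>\<^bsub>Hom D A Z\<^esub>"
    using f Cmp_zero_left[of A Z W "\<one>\<^bsub>Hom D A Z\<^esub>"] t W Zo by simp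
  from ET3[OF T etriangle_zero_left[OF Z W] _ f(1) this] t Zo
  obtain g where "g \<in> Mor D C W" "g \<odot> y = Idt D W \<odot> f" by auto
  then show thesis using that Cmp_Idt_left[of B W f] t W f by simp
qed

lemma factor_through_inflation:
  assumes T: "etriangle D A B C x y \<delta>" and W: "W \<in> Ob D"
    and f: "f \<in> Mor D W B" "y \<odot> f = \<one>\<^bsub>Hom D W C\<^esub>"
  obtains g where "g \<in> Mor D W A" "x \<odot> g = f"
proof -
  note t = etriangleD[OF T]
  obtain Z where Z: "zero_object D Z" using zero_object_exists by blast
  then have Zo: "Z \<in> Ob D" by (simp add: zero_object_def)
  have "y \<odot> f = \<one>\<^bsub>Hom D Z C\<^esub> \<odot> \<one>\<^bsub>Hom D W Z\<^esub>"
    using f Cmp_zero_left[of W Z C "\<one>\<^bsub>Hom D W Z\<^esub>"] t W Zo by simp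
  from ET3_op[OF etriangle_zero_right[OF Z W] T f(1) _ this] t Zo
  obtain g where "g \<in> Mor D W A" "x \<odot> g = f \<odot> Idt D W" by auto
  then show thesis using that Cmp_Idt_right[of W B f] t W f by simp
qed

text \<open>The pulled back class is zero, so the biproduct of \<open>A\<close> and \<open>W\<close>
  realizes it and maps to \<open>B\<close> over \<open>f\<close>; restrict this map to
  \<open>W\<close>.\<close>

lemma lift_through_deflation:
  assumes T: "etriangle D A B C x y \<delta>" and W: "W \<in> Ob D"
    and f: "f \<in> Mor D W C" "pull D A \<delta> f = \<one>\<^bsub>Ext D W A\<^esub>"
  obtains g where "g \<in> Mor D W B" "y \<odot> g = f"
proof -
  note t = etriangleD[OF T]
  obtain S i1 i2 p1 p2 where b: "is_biproduct D A W (S, i1, i2, p1, p2)"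
    using biproduct_exists[of A W] t W by (metis prod_cases5)
  then have S: "S \<in> Ob D" "i1 \<in> Mor D A S" "i2 \<in> Mor D W S" "p2 \<in> Mor D S W"
    "p2 \<odot> i2 = Idt D W" by (auto simp: is_biproduct_def)
  have "etriangle D A S W i1 p2 \<one>\<^bsub>Ext D W A\<^esub>"
    using Rlz_zero[OF _ _ b] S t W by (simp add: etriangle_def)
  from Rlz_morphism[OF this T Idt_closed[OF t(1)] f(1)]
  obtain h where h: "h \<in> Mor D S B" "y \<odot> h = f \<odot> p2"
    using f push_Idt[of W A] t W by auto
  have "y \<odot> (h \<odot> i2) = (y \<odot> h) \<odot> i2"
    using Cmp_assoc[of W S B C i2 h y] h S t W by simp
  also have "\<dots> = f"
    using Cmp_assoc[of W S W C i2 p2 f] h S t W f Cmp_Idt_right[of W C f] by simp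
  finally show thesis using that[of "h \<odot> i2"] Cmp_closed[of W S B i2 h] h S t W by simp
qed

text \<open>Dually, \<open>B\<close> maps to the biproduct of \<open>W\<close> and \<open>C\<close>;
  project to \<open>W\<close>.\<close>

lemma extend_along_inflation:
  assumes T: "etriangle D A B C x y \<delta>" and W: "W \<in> Ob D"
    and f: "f \<in> Mor D A W" "push D C f \<delta> = \<one>\<^bsub>Ext D C W\<^esub>"
  obtains g where "g \<in> Mor D B W" "g \<odot> x = f"
proof -
  note t = etriangleD[OF T]
  obtain S i1 i2 p1 p2 where b: "is_biproduct D W C (S, i1, i2, p1, p2)"
    using biproduct_exists[of W C] t W by (metis prod_cases5)
  then have S: "S \<in> Ob D" "i1 \<in> Mor D W S" "p1 \<in> Mor D S W" "p2 \<in> Mor D S C"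
    "p1 \<odot> i1 = Idt D W" by (auto simp: is_biproduct_def)
  have "etriangle D W S C i1 p2 \<one>\<^bsub>Ext D C W\<^esub>"
    using Rlz_zero[OF _ _ b] S t W by (simp add: etriangle_def)
  from Rlz_morphism[OF T this f(1) Idt_closed[OF t(3)]]
  obtain h where h: "h \<in> Mor D B S" "h \<odot> x = i1 \<odot> f"
    using f pull_Idt[of C W] t W by auto
  have "(p1 \<odot> h) \<odot> x = p1 \<odot> (i1 \<odot> f)"
    using Cmp_assoc[of A B S W x h p1] h S t W by simp
  also have "\<dots> = f"
    using Cmp_assoc[of A W S W f i1 p1] h S t W f Cmp_Idt_left[of A W f] by simp
  finally show thesis using that[of "p1 \<odot> h"] Cmp_closed[of B S W h p1] h S t W by simp
qed

text \<open>\<open>x\<close> extends along the inflation of a realization of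
  \<open>\<alpha>\<close>, and \<open>ET3\<close> completes this to a morphism of conflations with
  third component \<open>f\<close>.\<close>

lemma Ext_exact_left_end:
  assumes T: "etriangle D A B C x y \<delta>" and W: "W \<in> Ob D"
    and \<alpha>: "\<alpha> \<in> carrier (Ext D W A)" "push D W x \<alpha> = \<one>\<^bsub>Ext D W B\<^esub>"
  obtains f where "f \<in> Mor D W C" "\<alpha> = pull D A \<delta> f"
proof -
  note t = etriangleD[OF T]
  obtain M x' y' where T': "etriangle D A M W x' y' \<alpha>"
    using etriangle_exists[OF t(1) W \<alpha>(1)] by blast
  obtain b where b: "b \<in> Mor D M B" "b \<odot> x' = x"
    using extend_along_inflation[OF T' t(2) t(4) \<alpha>(2)] by blast
  have "b \<odot> x' = x \<odot> Idt D A" using b Cmp_Idt_right[of A B x] t by simp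
  from ET3[OF T' T Idt_closed[OF t(1)] b(1) this]
  obtain c where "c \<in> Mor D W C" "push D W (Idt D A) \<alpha> = pull D A \<delta> c" by blast
  then show thesis using that push_Idt[of W A \<alpha>] \<alpha> t W by simp
qed

text \<open>By \<open>ET4\<close> the third term \<open>E\<close> of the composite inflation is an
  extension of \<open>W\<close> by \<open>C\<close> with class \<open>push D W y \<beta>\<close>,
  which is zero. A section of \<open>E -> W\<close> pulls \<open>\<delta>''\<close> back to the
  required \<open>\<alpha>\<close>.\<close>

lemma Ext_exact_covariant:
  assumes T: "etriangle D A B C x y \<delta>" and W: "W \<in> Ob D"
    and \<beta>: "\<beta> \<in> carrier (Ext D W B)" "push D W y \<beta> = \<one>\<^bsub>Ext D W C\<^esub>"
  obtains \<alpha> where "\<alpha> \<in> carrier (Ext D W A)" "\<beta> = push D W x \<alpha>"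
proof -
  note t = etriangleD[OF T]
  obtain M g g' where T': "etriangle D B M W g g' \<beta>"
    using etriangle_exists[OF t(2) W \<beta>(1)] by blast
  obtain E h' d e \<delta>'' where E: "etriangle D A M E (g \<odot> x) h' \<delta>''"
    "etriangle D C E W d e (push D W y \<beta>)" "push D E x \<delta>'' = pull D B \<beta> e"
    using ET4[OF T T'] by blast
  note e = etriangleD[OF E(1)] etriangleD[OF E(2)]
  have "pull D C (push D W y \<beta>) (Idt D W) = \<one>\<^bsub>Ext D W C\<^esub>"
    using pull_Idt[of W C] \<beta> t W by simp
  from lift_through_deflation[OF E(2) W Idt_closed[OF W] this]
  obtain s where s: "s \<in> Mor D W E" "e \<odot> s = Idt D W" by blast
  have "push D W x (pull D A \<delta>'' s) = pull D B (push D E x \<delta>'') s"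
    using push_pull[of E W A B s x \<delta>''] e t W s by simp
  also have "\<dots> = \<beta>"
    using E(3) pull_pull[of W E W B e s \<beta>] e t W s \<beta> pull_Idt[of W B \<beta>] by simp
  finally show thesis
    using that[of "pull D A \<delta>'' s"] pull_closed[of E W A s \<delta>''] e t W s by simp
qed

text \<open>Dual: \<open>ET4_op\<close> yields a split extension \<open>W -> E -> A\<close>, and a
  retraction \<open>E -> W\<close> pushes \<open>\<delta>''\<close> to the required
  \<open>\<gamma>\<close>.\<close>

lemma Ext_exact_contravariant:
  assumes T: "etriangle D A B C x y \<delta>" and W: "W \<in> Ob D"
    and \<beta>: "\<beta> \<in> carrier (Ext D B W)" "pull D W \<beta> x = \<one>\<^bsub>Ext D A W\<^esub>"
  obtains \<gamma> where "\<gamma> \<in> carrier (Ext D C W)" "\<beta> = pull D W \<gamma> y"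
proof -
  note t = etriangleD[OF T]
  obtain M f' f where T': "etriangle D W M B f' f \<beta>"
    using etriangle_exists[OF W t(2) \<beta>(1)] by blast
  obtain E h' d e \<delta>'' where E: "etriangle D E M C h' (y \<odot> f) \<delta>''"
    "etriangle D W E A d e (pull D W \<beta> x)" "push D B d \<beta> = pull D E \<delta>'' y"
    using ET4_op[OF T' T] by blast
  note e = etriangleD[OF E(1)] etriangleD[OF E(2)]
  have "push D A (Idt D W) (pull D W \<beta> x) = \<one>\<^bsub>Ext D A W\<^esub>"
    using push_Idt[of A W] \<beta> t W by simp
  from extend_along_inflation[OF E(2) W Idt_closed[OF W] this]
  obtain r where r: "r \<in> Mor D E W" "r \<odot> d = Idt D W" by blast
  have "pull D W (push D C r \<delta>'') y = push D B r (pull D E \<delta>'' y)"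
    using push_pull[of C B E W y r \<delta>''] e t W r by simp
  also have "\<dots> = \<beta>"
    using E(3)[symmetric] push_push[of B W E W d r \<beta>] e t W r \<beta> push_Idt[of B W \<beta>] by simp
  finally show thesis
    using that[of "push D C r \<delta>''"] push_closed[of C E W r \<delta>''] e t W r by simp
qed

end

section \<open>Vanishing of second extensions\<close>

text \<open>
  The vanishing of \<open>\<E>\<^sup>2(V, B)\<close> in terms of \<open>\<E>\<close> alone: the class of \<open>(\<delta>, \<eta>)\<close> is zero as soon as \<open>\<delta>\<close>
  extends along the inflation \<open>n\<close> of a conflation realizing \<open>\<eta>\<close>, for then
  \<open>(\<zeta> \<cdot> n, \<eta>) \<approx> (\<zeta>, n \<cdot> \<eta>) = (\<zeta>, 0)\<close>.
\<close>

definition splices_vanish :: "('o, 'm, 'e, 'z) extri_cat_scheme \<Rightarrow> 'o \<Rightarrow> 'o \<Rightarrow> bool"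
  where "splices_vanish D V B \<longleftrightarrow> (\<forall>C N n v \<eta>. etriangle D C N V n v \<eta> \<longrightarrow>
    (\<forall>\<delta> \<in> carrier (Ext D C B). \<exists>\<zeta> \<in> carrier (Ext D N B). \<delta> = pull D B \<zeta> n))"

lemma splices_vanishE:
  assumes "splices_vanish D V B" "etriangle D C N V n v \<eta>" "\<delta> \<in> carrier (Ext D C B)"
  obtains \<zeta> where "\<zeta> \<in> carrier (Ext D N B)" "\<delta> = pull D B \<zeta> n"
  using assms unfolding splices_vanish_def by blast

context extriangulated_category
begin

text \<open>The obstruction to extending \<open>y\<close> along \<open>n\<close> lies in the trivial
  group \<open>Ext D V Y\<close>; pull \<open>\<theta>\<close> back along an extension of
  \<open>y\<close>.\<close>

lemma pull_extends:
  assumes T: "etriangle D C N V n v \<eta>" and Y: "trivial_group (Ext D V Y)" "Y \<in> Ob D"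
    and B: "B \<in> Ob D" and y: "y \<in> Mor D C Y" and \<theta>: "\<theta> \<in> carrier (Ext D Y B)"
  obtains \<zeta> where "\<zeta> \<in> carrier (Ext D N B)" "pull D B \<theta> y = pull D B \<zeta> n"
proof -
  note t = etriangleD[OF T]
  have "push D V y \<eta> = \<one>\<^bsub>Ext D V Y\<^esub>"
    using push_closed[of V C Y y \<eta>] t Y y by (auto simp: trivial_group_def)
  from extend_along_inflation[OF T Y(2) y this]
  obtain g where g: "g \<in> Mor D N Y" "g \<odot> n = y" by blast
  then have "pull D B \<theta> y = pull D B (pull D B \<theta> g) n"
    using pull_pull[of Y N C B g n \<theta>] t Y B \<theta> by simp
  then show thesis using that pull_closed[of Y N B g \<theta>] g t Y B \<theta> by blast
qed

text \<open>Dimension shift by a diagram chase: extend \<open>push D C i \<delta>\<close> over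
  \<open>N\<close>, lift the result to a class \<open>\<zeta>\<close> with values in
  \<open>B\<close>, and correct the difference between \<open>\<delta>\<close> and the restriction
  of \<open>\<zeta>\<close>.\<close>

lemma splices_vanish_of_conflation:
  assumes T: "etriangle D B M Y i p \<theta>"
    and M: "splices_vanish D V M" and Y: "trivial_group (Ext D V Y)"
  shows "splices_vanish D V B"
  unfolding splices_vanish_def
proof (intro allI impI ballI)
  fix C N n v \<eta> \<delta>
  assume E: "etriangle D C N V n v \<eta>" and \<delta>: "\<delta> \<in> carrier (Ext D C B)"
  note t = etriangleD[OF T] and e = etriangleD[OF E]
  obtain \<epsilon> where \<epsilon>: "\<epsilon> \<in> carrier (Ext D N M)" "push D C i \<delta> = pull D M \<epsilon> n"
    using splices_vanishE[OF M E push_closed[OF e(1) t(1,2,4) \<delta>]] by blast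
  \<comment> \<open>As \<open>p \<odot> i\<close> is zero, \<open>push D N p \<epsilon>\<close>
    restricts to zero along \<open>n\<close>, hence comes from \<open>Ext D V Y\<close>.\<close>
  have "pull D Y (push D N p \<epsilon>) n = push D C p (push D C i \<delta>)"
    using push_pull[of N C M Y n p \<epsilon>] \<epsilon> t e by simp
  also have "\<dots> = \<one>\<^bsub>Ext D C Y\<^esub>"
    using push_push[of C B M Y i p \<delta>] push_zero[of C B Y \<delta>] etriangle_Cmp_zero[OF T] t e \<delta>
    by simp
  finally obtain \<psi> where \<psi>: "\<psi> \<in> carrier (Ext D V Y)" "push D N p \<epsilon> = pull D Y \<psi> v"
    using Ext_exact_contravariant[OF E t(3) push_closed[OF e(2) t(2,3,5) \<epsilon>(1)]] by blast
  have "push D N p \<epsilon> = \<one>\<^bsub>Ext D N Y\<^esub>"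
    using \<psi> Y pull_one[of V N Y v] t e by (auto simp: trivial_group_def)
  then obtain \<zeta> where \<zeta>: "\<zeta> \<in> carrier (Ext D N B)" "\<epsilon> = push D N i \<zeta>"
    using Ext_exact_covariant[OF T e(2) \<epsilon>(1)] by blast
  let ?G = "Ext D C B" and ?z = "pull D B \<zeta> n"
  interpret G: comm_group ?G using F_comm_group t e by blast
  have z: "?z \<in> carrier ?G" using pull_closed[OF e(2,1) t(1) e(4) \<zeta>(1)] .
  interpret h: group_hom ?G "Ext D C M" "push D C i"
    using push_hom[of C B M i] t e by (simp add: group_hom_def group_hom_axioms_def)
  have "push D C i ?z = push D C i \<delta>"
    using push_pull[of N C B M n i \<zeta>] \<zeta> \<epsilon> t e by simp
  \<comment> \<open>Being killed by \<open>i\<close>, the difference is a pullback of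
    \<open>\<theta>\<close> along some \<open>C -> Y\<close>, to which \<open>pull_extends\<close>
    applies.\<close>
  then have "push D C i (\<delta> \<otimes>\<^bsub>?G\<^esub> inv\<^bsub>?G\<^esub> ?z) = \<one>\<^bsub>Ext D C M\<^esub>"
    using z \<delta> by (simp add: h.H.r_inv)
  then obtain y where y: "y \<in> Mor D C Y" "\<delta> \<otimes>\<^bsub>?G\<^esub> inv\<^bsub>?G\<^esub> ?z = pull D B \<theta> y"
    using Ext_exact_left_end[OF T e(1) G.m_closed[OF \<delta> G.inv_closed[OF z]]] by blast
  obtain \<xi> where \<xi>: "\<xi> \<in> carrier (Ext D N B)" "pull D B \<theta> y = pull D B \<xi> n"
    using pull_extends[OF E Y t(3) t(1) y(1) t(6)] by blast
  have "\<delta> = (\<delta> \<otimes>\<^bsub>?G\<^esub> inv\<^bsub>?G\<^esub> ?z) \<otimes>\<^bsub>?G\<^esub> ?z" using \<delta> z by (simp add: G.m_assoc)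
  also have "\<dots> = pull D B \<xi> n \<otimes>\<^bsub>?G\<^esub> ?z" using y \<xi> by simp
  also have "\<dots> = pull D B (\<xi> \<otimes>\<^bsub>Ext D N B\<^esub> \<zeta>) n"
    using hom_mult[OF pull_hom[of N C B n]] \<xi> \<zeta> t e by simp
  finally show "\<exists>\<zeta> \<in> carrier (Ext D N B). \<delta> = pull D B \<zeta> n"
    using monoid.m_closed[OF group.is_monoid[OF group_Ext[OF e(2) t(1)]] \<xi>(1) \<zeta>(1)]
    by (rule bexI)
qed

text \<open>The vanishing is applied to \<open>\<kappa>\<close> itself: it extends over
  \<open>N\<close>, and \<open>ET4_op\<close> writes \<open>\<phi>\<close> as a push along
  \<open>k\<close> from a second realization \<open>A -> K -> C\<close> of \<open>\<kappa>\<close>.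
  As \<open>k\<close> factors through \<open>B\<close>, the class \<open>\<phi>\<close> passes
  through \<open>Ext D V B\<close>.\<close>

lemma trivial_Ext_cokernel:
  assumes T: "etriangle D A B C x y \<kappa>" and V: "V \<in> Ob D"
    and A: "splices_vanish D V A" and B: "trivial_group (Ext D V B)"
  shows "trivial_group (Ext D V C)"
proof (rule trivial_ExtI)
  note t = etriangleD[OF T]
  show "V \<in> Ob D" "C \<in> Ob D" using V t by auto
  fix \<phi> assume \<phi>: "\<phi> \<in> carrier (Ext D V C)"
  obtain N n v where E: "etriangle D C N V n v \<phi>" using etriangle_exists[OF t(3) V \<phi>] by blast
  note e = etriangleD[OF E]
  obtain \<zeta> where \<zeta>: "\<zeta> \<in> carrier (Ext D N A)" "\<kappa> = pull D A \<zeta> n"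
    using splices_vanishE[OF A E t(6)] by blast
  obtain P f' f where P: "etriangle D A P N f' f \<zeta>" using etriangle_exists[OF t(1) e(2) \<zeta>(1)] by blast
  obtain K h' d k \<delta>'' where K: "etriangle D K P V h' (v \<odot> f) \<delta>''"
    "etriangle D A K C d k \<kappa>" "push D V k \<delta>'' = \<phi>"
    using ET4_op[OF P E] unfolding \<zeta>(2)[symmetric] by blast
  note k = etriangleD[OF K(1)] etriangleD[OF K(2)]
  have "push D C (Idt D A) \<kappa> = pull D A \<kappa> (Idt D C)" using push_Idt pull_Idt t by simp
  from Rlz_morphism[OF K(2) T Idt_closed[OF t(1)] Idt_closed[OF t(3)] this]
  obtain b where b: "b \<in> Mor D K B" "y \<odot> b = Idt D C \<odot> k" by blast
  have "\<phi> = push D V (y \<odot> b) \<delta>''" using K b Cmp_Idt_left[of K C k] k by simp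
  also have "\<dots> = push D V y (push D V b \<delta>'')" using push_push[of V K B C b y \<delta>''] k t b by simp
  also have "push D V b \<delta>'' = \<one>\<^bsub>Ext D V B\<^esub>"
    using push_closed[of V K B b \<delta>''] k t b B by (auto simp: trivial_group_def)
  finally show "\<phi> = \<one>\<^bsub>Ext D V C\<^esub>" using push_one[of V B C y] t V by simp
qed

section \<open>From extendable classes to the group \<open>hext\<close> and to
  \<open>pd\<close>\<close>

lemma hext_equiv_words:
  "hext_equiv D n A B w w' \<Longrightarrow> A \<in> Ob D \<Longrightarrow> B \<in> Ob D \<Longrightarrow>
    w \<in> hext_words D n A B \<and> w' \<in> hext_words D n A B"
proof (induction rule: hext_equiv.induct)
  case (slide X Y f \<delta> B w n A)
  have "word_push D A f w \<in> hext_words D n A Y"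
    using slide push_closed by (cases n) auto
  then show ?case using slide pull_closed[of Y X B f \<delta>] by auto
qed auto

lemma splices_vanish_imp_hext_trivial:
  assumes V: "V \<in> Ob D" and B: "B \<in> Ob D" and van: "splices_vanish D V B"
  shows "trivial_group (hext D 1 V B)"
proof -
  let ?W = "hext_words D (Suc 0) V B" and ?R = "hext_rel D (Suc 0) V B"
  let ?w0 = "word_zero D (Suc 0) V B"
  have null: "hext_equiv D (Suc 0) V B w ?w0" if wW: "w \<in> ?W" for w
  proof -
    obtain C \<delta> \<eta> where w: "w = Splice C \<delta> (Single \<eta>)" "C \<in> Ob D" "\<delta> \<in> carrier (Ext D C B)"
      "\<eta> \<in> carrier (Ext D V C)" using wW by auto
    obtain N n v where E: "etriangle D C N V n v \<eta>" using etriangle_exists[OF w(2) V w(4)] by blast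
    note e = etriangleD[OF E]
    obtain \<zeta> where \<zeta>: "\<zeta> \<in> carrier (Ext D N B)" "\<delta> = pull D B \<zeta> n"
      using splices_vanishE[OF van E w(3)] by blast
    have "hext_equiv D (Suc 0) V B w (Splice N \<zeta> (Single \<one>\<^bsub>Ext D V N\<^esub>))"
      using hext_equiv.slide[of C D N n \<zeta> B "Single \<eta>" 0 V] e w \<zeta> etriangle_push_zero[OF E] by simp
    \<comment> \<open>The zero word slides along the zero morphism \<open>B -> N\<close> to the same
      word.\<close>
    moreover have "hext_equiv D (Suc 0) V B ?w0 (Splice N \<zeta> (Single \<one>\<^bsub>Ext D V N\<^esub>))"
      using hext_equiv.slide[of B D N "\<one>\<^bsub>Hom D B N\<^esub>" \<zeta> B "Single \<one>\<^bsub>Ext D V B\<^esub>" 0 V]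
        e B V \<zeta> pull_zero[of N B B \<zeta>] push_zero[of V B N] by simp
    ultimately show ?thesis by (rule hext_equiv.trans[OF _ hext_equiv.sym])
  qed
  have zero: "?w0 \<in> ?W" using V B by simp
  have R: "?R = ?W \<times> ?W"
  proof
    show "?R \<subseteq> ?W \<times> ?W" using hext_equiv_words[OF _ V B] unfolding hext_rel_def by blast
    show "?W \<times> ?W \<subseteq> ?R"
      using hext_equiv.trans[OF null hext_equiv.sym[OF null]] unfolding hext_rel_def by blast
  qed
  \<comment> \<open>Baer sums must be words again, so that the only class is closed under the
    product.\<close>
  have add: "word_add D V B w w' \<in> ?W" if wW: "w \<in> ?W" "w' \<in> ?W" for w w'
  proof -
    obtain X \<delta> \<eta> where w: "w = Splice X \<delta> (Single \<eta>)" "X \<in> Ob D" "\<delta> \<in> carrier (Ext D X B)"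
      "\<eta> \<in> carrier (Ext D V X)" using wW(1) by auto
    obtain Y \<delta>' \<eta>' where w': "w' = Splice Y \<delta>' (Single \<eta>')" "Y \<in> Ob D" "\<delta>' \<in> carrier (Ext D Y B)"
      "\<eta>' \<in> carrier (Ext D V Y)" using wW(2) by auto
    obtain S m1 m2 p1 p2 where b: "biproduct D X Y = (S, m1, m2, p1, p2)" by (metis prod_cases5)
    then have S: "S \<in> Ob D" "m1 \<in> Mor D X S" "m2 \<in> Mor D Y S" "p1 \<in> Mor D S X" "p2 \<in> Mor D S Y"
      using is_biproduct_biproduct[OF w(2) w'(2)] by (auto simp: is_biproduct_def)
    have "word_add D V B w w' = Splice S (pull D B \<delta> p1 \<otimes>\<^bsub>Ext D S B\<^esub> pull D B \<delta>' p2)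
        (Single (push D V m1 \<eta> \<otimes>\<^bsub>Ext D V S\<^esub> push D V m2 \<eta>'))"
      using b w(1) w'(1) by simp
    moreover have "pull D B \<delta> p1 \<otimes>\<^bsub>Ext D S B\<^esub> pull D B \<delta>' p2 \<in> carrier (Ext D S B)"
      using monoid.m_closed[OF group.is_monoid[OF group_Ext[OF S(1) B]]]
        pull_closed[OF w(2) S(1) B S(4) w(3)] pull_closed[OF w'(2) S(1) B S(5) w'(3)] by blast
    moreover have "push D V m1 \<eta> \<otimes>\<^bsub>Ext D V S\<^esub> push D V m2 \<eta>' \<in> carrier (Ext D V S)"
      using monoid.m_closed[OF group.is_monoid[OF group_Ext[OF V S(1)]]]
        push_closed[OF V w(2) S(1) S(2) w(4)] push_closed[OF V w'(2) S(1) S(3) w'(4)] by blast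
    ultimately show ?thesis using S(1) by simp
  qed
  define W where "W = ?W"
  define G where "G = hext D 1 V B"
  note W = zero[folded W_def] add[folded W_def] R[folded W_def]
  have G: "carrier G = {W}" "\<one>\<^bsub>G\<^esub> = W" "W \<otimes>\<^bsub>G\<^esub> W = W"
    using W unfolding G_def hext_def One_nat_def W(3) W_def[symmetric]
    by (auto simp: quotient_def simp del: word_zero.simps)
  have "group G"
    by (rule groupI) (simp_all add: G)
  then have "trivial_group G" using G by (simp add: trivial_group_def)
  then show ?thesis by (simp add: G_def)
qed

lemma pd_le_1:
  assumes "V \<in> Ob D" "\<And>B. B \<in> Ob D \<Longrightarrow> splices_vanish D V B"
  shows "pd D V \<le> 1"
proof -
  \<comment> \<open>By the index shift, \<open>hext D 1 V B\<close> is the second extension group,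
    so 1 is admissible in the minimum defining \<open>pd\<close>.\<close>
  have "hext_vanishes D V 1"
    using splices_vanish_imp_hext_trivial assms unfolding hext_vanishes_def by blast
  then show ?thesis
    by (auto simp: pd_def one_enat_def intro: Least_le)
qed

end

section \<open>Extended tilting objects\<close>

context neg_extriangulated_category
begin

text \<open>The kernel of composition with \<open>x\<close> is the image of
  \<open>NExt D W C\<close> under the connecting map.\<close>

lemma inflation_mono_of_NExt:
  assumes T: "etriangle D A B C x y \<delta>" and W: "W \<in> Ob D"
    and N: "trivial_group (NExt D W C)"
    and f: "f \<in> Mor D W A" "x \<odot> f = \<one>\<^bsub>Hom D W B\<^esub>"
  shows "f = \<one>\<^bsub>Hom D W A\<^esub>"
proof -
  note t = etriangleD[OF T]
  have "f \<in> kernel (Hom D W A) (Hom D W B) (\<lambda>f. x \<odot> f)" using f by (simp add: kernel_def)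
  then have "f \<in> dsup D C A \<delta> W ` carrier (NExt D W C)"
    using exact_covariant[OF T W] by (simp add: exact_at_def)
  moreover have "dsup D C A \<delta> W \<one>\<^bsub>NExt D W C\<^esub> = \<one>\<^bsub>Hom D W A\<^esub>"
    using hom_one[OF dsup_hom[OF t(1,3) W t(6)]] N t(1) W by (simp add: trivial_group_def)
  ultimately show ?thesis using N by (auto simp: trivial_group_def)
qed

lemma deflation_epi_of_NExt:
  assumes T: "etriangle D A B C x y \<delta>" and W: "W \<in> Ob D"
    and N: "trivial_group (NExt D A W)"
    and f: "f \<in> Mor D C W" "f \<odot> y = \<one>\<^bsub>Hom D B W\<^esub>"
  shows "f = \<one>\<^bsub>Hom D C W\<^esub>"
proof -
  note t = etriangleD[OF T]
  have "f \<in> kernel (Hom D C W) (Hom D B W) (\<lambda>f. f \<odot> y)" using f by (simp add: kernel_def)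
  then have "f \<in> dsub D C A \<delta> W ` carrier (NExt D A W)"
    using exact_contravariant[OF T W] by (simp add: exact_at_def)
  moreover have "dsub D C A \<delta> W \<one>\<^bsub>NExt D A W\<^esub> = \<one>\<^bsub>Hom D C W\<^esub>"
    using hom_one[OF dsub_hom[OF t(1,3) W t(6)]] N t(3) W by (simp add: trivial_group_def)
  ultimately show ?thesis using N by (auto simp: trivial_group_def)
qed

end

locale extended_tilting_object = neg_extriangulated_category D
  for D :: "('o, 'm, 'e, 'n, 'z) neg_extri_cat_scheme" (structure) +
  fixes V :: 'o
  assumes tilting: "extended_tilting D V"
begin

section \<open>The torsion pair and second extensions into torsion objects\<close>

lemma V_Ob: "V \<in> Ob D"
  using tilting by (simp add: extended_tilting_def)

lemma torsion_pair: "s_torsion_pair D (Gen D V) (perp0 D V)"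
  using tilting unfolding extended_tilting_def by blast

lemma Gen_Ob: "X \<in> Gen D V \<Longrightarrow> X \<in> Ob D"
  by (simp add: Gen_def)

lemma perp0_Ob: "X \<in> perp0 D V \<Longrightarrow> X \<in> Ob D"
  by (simp add: perp0_def)

lemma Hom_Gen_perp0:
  "\<lbrakk>T \<in> Gen D V; F \<in> perp0 D V; f \<in> Mor D T F\<rbrakk> \<Longrightarrow> f = \<one>\<^bsub>Hom D T F\<^esub>"
  using torsion_pair trivial_Hom_zero by (auto simp: s_torsion_pair_def)

lemma NExt_Gen_perp0:
  "\<lbrakk>T \<in> Gen D V; F \<in> perp0 D V\<rbrakk> \<Longrightarrow> trivial_group (NExt D T F)"
  using torsion_pair by (auto simp: s_torsion_pair_def)

lemma torsion_triangle:
  assumes "X \<in> Ob D"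
  obtains T F x y \<delta> where "etriangle D T X F x y \<delta>" "T \<in> Gen D V" "F \<in> perp0 D V"
  using torsion_pair assms unfolding s_torsion_pair_def conflation_def by blast

lemma Ext_Gen: "T \<in> Gen D V \<Longrightarrow> trivial_group (Ext D V T)"
  using tilting by (auto simp: extended_tilting_def perp1_def)

lemma cogenerating_triangle:
  assumes "X \<in> Ob D"
  obtains S X' x y \<delta> where "etriangle D X S X' x y \<delta>" "S \<in> Gen D V"
  using tilting assms unfolding extended_tilting_def cogenerating_def conflation_def by blast

text \<open>The map from \<open>W\<close> to its torsion-free part is zero, so every class comes
  from the torsion part \<open>T\<close>, where \<open>Ext D V T\<close> vanishes.\<close>

lemma trivial_Ext_of_left_orthogonal:
  assumes W: "W \<in> Ob D"
    and orth: "\<And>F f. \<lbrakk>F \<in> perp0 D V; f \<in> Mor D W F\<rbrakk> \<Longrightarrow> f = \<one>\<^bsub>Hom D W F\<^esub>"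
  shows "trivial_group (Ext D V W)"
proof (rule trivial_ExtI)
  show "V \<in> Ob D" "W \<in> Ob D" using V_Ob W .
  fix \<beta> assume \<beta>: "\<beta> \<in> carrier (Ext D V W)"
  obtain T F x y \<delta> where T: "etriangle D T W F x y \<delta>" "T \<in> Gen D V" "F \<in> perp0 D V"
    using torsion_triangle[OF W] by blast
  note t = etriangleD[OF T(1)]
  have "y = \<one>\<^bsub>Hom D W F\<^esub>" using orth T(3) t(5) by blast
  then have "push D V y \<beta> = \<one>\<^bsub>Ext D V F\<^esub>" using push_zero[OF V_Ob W t(3) \<beta>] by simp
  then obtain \<alpha> where "\<alpha> \<in> carrier (Ext D V T)" "\<beta> = push D V x \<alpha>"
    using Ext_exact_covariant[OF T(1) V_Ob \<beta>] by blast
  then show "\<beta> = \<one>\<^bsub>Ext D V W\<^esub>"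
    using Ext_Gen[OF T(2)] push_one[OF V_Ob t(1,2,4)] by (auto simp: trivial_group_def)
qed

lemma splices_vanish_Gen:
  assumes B: "B \<in> Gen D V"
  shows "splices_vanish D V B"
  unfolding splices_vanish_def
proof (intro allI impI ballI)
  fix C N n v \<eta> \<delta>
  assume E: "etriangle D C N V n v \<eta>" and \<delta>: "\<delta> \<in> carrier (Ext D C B)"
  note e = etriangleD[OF E]
  obtain M f f' where M: "etriangle D B M C f f' \<delta>"
    using etriangle_exists[OF Gen_Ob[OF B] e(1) \<delta>] by blast
  note m = etriangleD[OF M]
  \<comment> \<open>Embed the middle term of \<open>\<delta>\<close> into a torsion object;
    \<open>ET4\<close> for \<open>B -> M -> S\<close> then presents \<open>\<delta>\<close> as a
    pullback of an extension \<open>B -> S -> W\<close>.\<close>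
  obtain S Y g g' \<delta>' where S: "etriangle D M S Y g g' \<delta>'" "S \<in> Gen D V"
    using cogenerating_triangle[OF m(2)] by blast
  obtain W h' d \<delta>'' where W: "etriangle D B S W (g \<odot> f) h' \<delta>''" "d \<in> Mor D C W"
    "pull D B \<delta>'' d = \<delta>"
    using ET4[OF M S(1)] by blast
  note w = etriangleD[OF W(1)]
  \<comment> \<open>A map from \<open>W\<close> to a torsion-free \<open>F\<close> vanishes on
    \<open>S\<close>, and triviality of \<open>NExt D B F\<close> allows \<open>h'\<close> to be
    cancelled.\<close>
  have "k = \<one>\<^bsub>Hom D W F\<^esub>" if F: "F \<in> perp0 D V" and k: "k \<in> Mor D W F" for F k
  proof (rule deflation_epi_of_NExt[OF W(1) perp0_Ob[OF F] NExt_Gen_perp0[OF B F] k])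
    show "k \<odot> h' = \<one>\<^bsub>Hom D S F\<^esub>"
      using Hom_Gen_perp0[OF S(2) F] Cmp_closed[OF w(2,3) perp0_Ob[OF F] w(5) k] .
  qed
  from trivial_Ext_of_left_orthogonal[OF w(3) this] have "trivial_group (Ext D V W)" .
  from pull_extends[OF E this w(3,1) W(2) w(6)]
  show "\<exists>\<zeta> \<in> carrier (Ext D N B). \<delta> = pull D B \<zeta> n" using W(3) by metis
qed

text \<open>Second extensions of \<open>V\<close> into the torsion part vanish, so the vanishing of
  \<open>Ext D V X\<close> passes on to \<open>F\<close>.\<close>

lemma perp1_torsionfree_part:
  assumes "etriangle D T X F x y \<delta>" "T \<in> Gen D V" "F \<in> perp0 D V"
    and "trivial_group (Ext D V X)"
  shows "F \<in> perp0 D V \<inter> perp1 D V"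
  using trivial_Ext_cokernel[OF assms(1) V_Ob splices_vanish_Gen[OF assms(2)] assms(4)] assms(3)
    perp0_Ob by (simp add: perp1_def)

text \<open>
  As \<open>Hom(V, F) = 0\<close>, the map \<open>Hom(V, T) \<rightarrow> Hom(V, C)\<close> is injective, which keeps the composite of
  the deflations from a copower of \<open>V\<close> onto \<open>T\<close> and from \<open>T\<close> onto \<open>C\<close> different from zero.
\<close>

lemma Gen_cokernel_of_perp0:
  assumes T: "etriangle D F T C x y \<delta>" and F: "F \<in> perp0 D V"
    and TG: "T \<in> Gen D V" and nz: "\<not> zero_object D T"
  shows "C \<in> Gen D V"
proof -
  note t = etriangleD[OF T]
  obtain \<alpha> :: "'m set" and \<iota> Q A a f \<kappa> where Q: "is_copower D V \<alpha> Q \<iota>"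
    "etriangle D A Q T a f \<kappa>" "f \<noteq> \<one>\<^bsub>Hom D Q T\<^esub>"
    using TG nz unfolding Gen_def conflation_def by blast
  note q = etriangleD[OF Q(2)]
  have \<iota>: "\<iota> i \<in> Mor D V Q" if "i \<in> \<alpha>" for i using Q(1) that by (simp add: is_copower_def)
  obtain E h' \<delta>'' where E: "etriangle D E Q C h' (y \<odot> f) \<delta>''"
    using ET4_op[OF Q(2) T] by blast
  have "y \<odot> f \<noteq> \<one>\<^bsub>Hom D Q C\<^esub>"
  proof
    assume 0: "y \<odot> f = \<one>\<^bsub>Hom D Q C\<^esub>"
    have f0: "f \<odot> \<iota> i = \<one>\<^bsub>Hom D V T\<^esub>" if i: "i \<in> \<alpha>" for i
    proof -
      have fi: "f \<odot> \<iota> i \<in> Mor D V T" using Cmp_closed[OF V_Ob q(2,3) \<iota>[OF i] q(5)] .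
      have "y \<odot> (f \<odot> \<iota> i) = \<one>\<^bsub>Hom D V C\<^esub>"
        using Cmp_assoc[OF V_Ob q(2) t(2,3) \<iota>[OF i] q(5) t(5)] 0
          Cmp_zero_left[OF V_Ob q(2) t(3) \<iota>[OF i]] by simp
      then obtain h where h: "h \<in> Mor D V F" "x \<odot> h = f \<odot> \<iota> i"
        using factor_through_inflation[OF T V_Ob fi] by blast
      then have "h = \<one>\<^bsub>Hom D V F\<^esub>" using F trivial_Hom_zero by (simp add: perp0_def)
      then show ?thesis using h Cmp_zero_right[OF V_Ob t(1,2,4)] by simp
    qed
    \<comment> \<open>Both \<open>f\<close> and the zero morphism solve the universal problem with
      zero data.\<close>
    have "\<exists>!h. h \<in> Mor D Q T \<and> (\<forall>i\<in>\<alpha>. h \<odot> \<iota> i = \<one>\<^bsub>Hom D V T\<^esub>)"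
      using Q(1) t(2) zero_Mor[OF V_Ob t(2)] unfolding is_copower_def by (elim conjE ballE allE) auto
    moreover have "\<one>\<^bsub>Hom D Q T\<^esub> \<odot> \<iota> i = \<one>\<^bsub>Hom D V T\<^esub>" if "i \<in> \<alpha>" for i
      using Cmp_zero_left[OF V_Ob q(2) t(2) \<iota>[OF that]] .
    ultimately have "f = \<one>\<^bsub>Hom D Q T\<^esub>" using f0 q(5) zero_Mor[OF q(2) t(2)] by blast
    with Q(3) show False by simp
  qed
  then show ?thesis using E Q(1) t(3) unfolding Gen_def conflation_def by blast
qed

section \<open>Reduction to torsion-free objects without extensions by \<open>V\<close>\<close>

text \<open>
  For \<open>B \<rightarrow> S \<rightarrow> C\<close> with \<open>S \<in> Gen V\<close>, let \<open>K\<close> be the preimage in \<open>S\<close> of the torsion part of \<open>C\<close>, with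
  torsion-free quotient \<open>F'\<close>.  The map \<open>S \<rightarrow> F'\<close> is zero, so \<open>p : K \<rightarrow> S\<close> has a section \<open>s\<close>; the
  complementary idempotent \<open>1 - s p\<close> vanishes on the torsion part of \<open>K\<close>, hence factors
  through the torsion-free part of \<open>K\<close>, which lies in \<open>\<F> \<inter> V\<^sup>\<bottom>\<^sup>1\<close>.
\<close>

lemma splices_vanish_if_on_torsionfree_perp1:
  assumes van: "\<And>F. F \<in> perp0 D V \<inter> perp1 D V \<Longrightarrow> splices_vanish D V F"
    and B: "B \<in> Ob D"
  shows "splices_vanish D V B"
proof -
  obtain S C f' f \<delta> where S: "etriangle D B S C f' f \<delta>" "S \<in> Gen D V"
    using cogenerating_triangle[OF B] by blast
  note s' = etriangleD[OF S(1)]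
  obtain T' F' g' g \<delta>' where C: "etriangle D T' C F' g' g \<delta>'" "T' \<in> Gen D V" "F' \<in> perp0 D V"
    using torsion_triangle[OF s'(3)] by blast
  note c = etriangleD[OF C(1)]
  obtain K p d e \<delta>'' where K: "etriangle D K S F' p (g \<odot> f) \<delta>''"
    "etriangle D B K T' d e (pull D B \<delta> g')"
    using ET4_op[OF S(1) C(1)] by blast
  note k = etriangleD[OF K(1)]
  have zero: "g \<odot> f = \<one>\<^bsub>Hom D S F'\<^esub>" using Hom_Gen_perp0[OF S(2) C(3) k(5)] .
  have "(g \<odot> f) \<odot> Idt D S = \<one>\<^bsub>Hom D S F'\<^esub>" using zero Cmp_Idt_right[OF k(2,3,5)] by simp
  then obtain s where s: "s \<in> Mor D S K" "p \<odot> s = Idt D S"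
    using factor_through_inflation[OF K(1) k(2) Idt_closed[OF k(2)]] by blast
  \<comment> \<open>Classes in \<open>Ext D V K\<close> die in \<open>Ext D V S\<close>, so they
    come from morphisms \<open>V -> F'\<close>, which are zero.\<close>
  have EK: "trivial_group (Ext D V K)"
  proof (rule trivial_ExtI[OF V_Ob k(1)])
    fix \<alpha> assume \<alpha>: "\<alpha> \<in> carrier (Ext D V K)"
    have "push D V p \<alpha> = \<one>\<^bsub>Ext D V S\<^esub>"
      using push_closed[OF V_Ob k(1,2,4) \<alpha>] Ext_Gen[OF S(2)] by (simp add: trivial_group_def)
    then obtain u where u: "u \<in> Mor D V F'" "\<alpha> = pull D K \<delta>'' u"
      using Ext_exact_left_end[OF K(1) V_Ob \<alpha>] by blast
    then have "u = \<one>\<^bsub>Hom D V F'\<^esub>" using C(3) trivial_Hom_zero by (simp add: perp0_def)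
    then show "\<alpha> = \<one>\<^bsub>Ext D V K\<^esub>" using u pull_zero[OF k(3) V_Ob k(1,6)] by simp
  qed
  obtain T L t q \<kappa> where T: "etriangle D T K L t q \<kappa>" "T \<in> Gen D V" "L \<in> perp0 D V"
    using torsion_triangle[OF k(1)] by blast
  note l = etriangleD[OF T(1)]
  have L: "splices_vanish D V L" using van perp1_torsionfree_part[OF T EK] .
  interpret HK: comm_group "Hom D K K" using Hom_comm_group[OF k(1,1)] .
  have sp: "s \<odot> p \<in> Mor D K K" using Cmp_closed[OF k(1,2,1,4) s(1)] .
  define c where "c = Idt D K \<otimes>\<^bsub>Hom D K K\<^esub> inv\<^bsub>Hom D K K\<^esub> (s \<odot> p)"
  have cK: "c \<in> Mor D K K" using sp Idt_closed[OF k(1)] by (simp add: c_def)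
  have split: "Idt D K = c \<otimes>\<^bsub>Hom D K K\<^esub> (s \<odot> p)"
    using sp Idt_closed[OF k(1)] by (simp add: c_def HK.m_assoc)
  have "p \<odot> c = \<one>\<^bsub>Hom D K S\<^esub>"
  proof -
    interpret HS: group "Hom D K S" using group_Hom[OF k(1,2)] .
    have pc: "p \<odot> c \<in> Mor D K S" using Cmp_closed[OF k(1,1,2) cK k(4)] .
    have "p \<odot> (s \<odot> p) = p"
      using Cmp_assoc[OF k(1,2,1,2,4) s(1) k(4)] s(2) Cmp_Idt_left[OF k(1,2,4)] by simp
    then have "(p \<odot> c) \<otimes>\<^bsub>Hom D K S\<^esub> p = p"
      using Cmp_add_right[OF k(1,1,2) cK sp k(4)] split Cmp_Idt_right[OF k(1,2,4)] by simp
    then show ?thesis using pc k(4) HS.r_cancel_one by blast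
  qed
  then have "p \<odot> (c \<odot> t) = \<one>\<^bsub>Hom D T S\<^esub>"
    using Cmp_assoc[OF l(1) k(1,1,2) l(4) cK k(4)] Cmp_zero_left[OF l(1) k(1,2) l(4)] by simp
  \<comment> \<open>\<open>p\<close> can be cancelled on maps from \<open>T\<close> because
    \<open>NExt D T F'\<close> is trivial.\<close>
  then have "c \<odot> t = \<one>\<^bsub>Hom D T K\<^esub>"
    by (rule inflation_mono_of_NExt[OF K(1) l(1) NExt_Gen_perp0[OF T(2) C(3)]
          Cmp_closed[OF l(1) k(1,1) l(4) cK]])
  then obtain r where r: "r \<in> Mor D L K" "r \<odot> q = c"
    using factor_through_deflation[OF T(1) k(1) cK] by blast
  have "splices_vanish D V K"
    unfolding splices_vanish_def
  proof (intro allI impI ballI)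
    fix X N n v \<eta> \<theta>
    assume E: "etriangle D X N V n v \<eta>" and \<theta>: "\<theta> \<in> carrier (Ext D X K)"
    note e = etriangleD[OF E]
    \<comment> \<open>The identity of \<open>K\<close> is \<open>c + s p\<close>, which divides the
      problem for \<open>\<theta>\<close>: one part passes through the torsion object
      \<open>S\<close>, the other through \<open>L\<close>.\<close>
    obtain \<zeta> where \<zeta>: "\<zeta> \<in> carrier (Ext D N S)" "push D X p \<theta> = pull D S \<zeta> n"
      using splices_vanishE[OF splices_vanish_Gen[OF S(2)] E push_closed[OF e(1) k(1,2,4) \<theta>]] by blast
    obtain \<xi> where \<xi>: "\<xi> \<in> carrier (Ext D N L)" "push D X q \<theta> = pull D L \<xi> n"
      using splices_vanishE[OF L E push_closed[OF e(1) l(2,3,5) \<theta>]] by blast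
    have "\<theta> = push D X c \<theta> \<otimes>\<^bsub>Ext D X K\<^esub> push D X (s \<odot> p) \<theta>"
      using push_add[OF e(1) k(1,1) cK sp \<theta>] split push_Idt[OF e(1) k(1) \<theta>] by simp
    also have "push D X (s \<odot> p) \<theta> = pull D K (push D N s \<zeta>) n"
      using push_push[OF e(1) k(1,2,1,4) s(1) \<theta>] \<zeta>(2)
        push_pull[OF e(2,1) k(2,1) e(4) s(1) \<zeta>(1)] by simp
    also have "push D X c \<theta> = pull D K (push D N r \<xi>) n"
      using push_push[OF e(1) k(1) l(3) k(1) l(5) r(1) \<theta>] \<xi>(2) r(2)
        push_pull[OF e(2,1) l(3) k(1) e(4) r(1) \<xi>(1)] by simp
    also have "pull D K (push D N r \<xi>) n \<otimes>\<^bsub>Ext D X K\<^esub> pull D K (push D N s \<zeta>) n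
      = pull D K (push D N r \<xi> \<otimes>\<^bsub>Ext D N K\<^esub> push D N s \<zeta>) n"
      using hom_mult[OF pull_hom[OF e(2,1) k(1) e(4)] push_closed[OF e(2) l(3) k(1) r(1) \<xi>(1)]
          push_closed[OF e(2) k(2,1) s(1) \<zeta>(1)]] by simp
    finally show "\<exists>\<zeta> \<in> carrier (Ext D N K). \<theta> = pull D K \<zeta> n"
      using monoid.m_closed[OF group.is_monoid[OF group_Ext[OF e(2) k(1)]]
          push_closed[OF e(2) l(3) k(1) r(1) \<xi>(1)] push_closed[OF e(2) k(2,1) s(1) \<zeta>(1)]]
      by (rule bexI)
  qed
  \<comment> \<open>Dimension shift along \<open>B -> K -> T'\<close> passes from \<open>K\<close>
    to \<open>B\<close>.\<close>
  from splices_vanish_of_conflation[OF K(2) this Ext_Gen[OF C(2)]] show ?thesis .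
qed

lemma splices_vanish_of_cokernel_perp1:
  assumes "etriangle D F T C x y \<delta>" "T \<in> Gen D V" "C \<in> perp1 D V"
  shows "splices_vanish D V F"
  using splices_vanish_of_conflation[OF assms(1) splices_vanish_Gen[OF assms(2)]] assms(3)
  by (simp add: perp1_def)

lemma Gen_subset_perp1: "Gen D V \<subseteq> perp1 D V"
  using tilting unfolding extended_tilting_def by blast

section \<open>The bound under each of the three conditions\<close>

lemma pd_le_1_if:
  assumes "(\<forall>F \<in> perp0 D V \<inter> perp1 D V. \<exists>T \<in> Gen D V. \<not> zero_object D T \<and>
        (\<exists>C' x y. conflation D F T C' x y))
      \<or> (\<forall>F \<in> perp0 D V \<inter> perp1 D V. \<forall>Z C' x y. zero_object D Z \<and> conflation D F Z C' x y
           \<longrightarrow> C' \<in> perp0 D V \<inter> perp1 D V)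
      \<or> Gen D V = perp1 D V"
  shows "pd D V \<le> 1"
proof (rule pd_le_1[OF V_Ob splices_vanish_if_on_torsionfree_perp1])
  fix F assume F: "F \<in> perp0 D V \<inter> perp1 D V"
  consider (a) T C x y where "T \<in> Gen D V" "\<not> zero_object D T" "conflation D F T C x y"
    | (b) "\<forall>Z C' x y. zero_object D Z \<and> conflation D F Z C' x y \<longrightarrow> C' \<in> perp1 D V"
    | (c) "F \<in> Gen D V"
    using assms F by blast
  then show "splices_vanish D V F"
  proof cases
    case a
    then show ?thesis
      using splices_vanish_of_cokernel_perp1 Gen_cokernel_of_perp0 Gen_subset_perp1 F
      unfolding conflation_def by blast
  next
    case b
    obtain S C x y \<delta> where S: "etriangle D F S C x y \<delta>" "S \<in> Gen D V"
      using cogenerating_triangle F perp0_Ob by blast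
    \<comment> \<open>If the torsion object \<open>S\<close> is zero, the condition on
      \<open>F -> 0 -> C'\<close> applies; otherwise \<open>C\<close> is itself torsion.\<close>
    have "C \<in> perp1 D V"
    proof (cases "zero_object D S")
      case True
      then show ?thesis using b S(1) unfolding conflation_def by blast
    next
      case False
      then show ?thesis using Gen_cokernel_of_perp0[OF S(1) _ S(2)] Gen_subset_perp1 F by blast
    qed
    then show ?thesis using splices_vanish_of_cokernel_perp1[OF S] by blast
  next
    case c
    then show ?thesis by (rule splices_vanish_Gen)
  qed
qed

section \<open>The exact case\<close>

text \<open>
  If \<open>F\<close> is torsion-free in \<open>V\<^sup>\<bottom>\<^sup>1\<close> and \<open>F \<rightarrow> S \<rightarrow> C\<close> with \<open>S \<in> Gen V\<close>, then \<open>C \<in> Pres V\<close>.  A presentation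
  \<open>Q \<rightarrow> C\<close> lifts to \<open>Q \<rightarrow> S\<close>; the lift maps the kernel, a torsion object, to \<open>F\<close>, so it factors
  through \<open>C\<close> and splits \<open>S \<rightarrow> C\<close>.  Thus \<open>F\<close> is a torsion-free summand of the torsion object \<open>S\<close>.
\<close>

lemma torsionfree_perp1_zero_if_kernels_cokernels:
  assumes ker: "\<And>A B C x y. conflation D A B C x y \<Longrightarrow>
      is_kernel D A B C x y \<and> is_cokernel D A B C x y"
    and F: "F \<in> perp0 D V \<inter> perp1 D V"
  shows "zero_object D F"
proof -
  have FO: "F \<in> Ob D" using F perp0_Ob by blast
  obtain S C x y \<delta> where S: "etriangle D F S C x y \<delta>" "S \<in> Gen D V"
    using cogenerating_triangle[OF FO] by blast
  note s = etriangleD[OF S(1)]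
  have mono: "h = h'" if "W \<in> Ob D" "h \<in> Mor D W F" "h' \<in> Mor D W F" "x \<odot> h = x \<odot> h'" for W h h'
  proof -
    have "is_kernel D F S C x y" using ker S(1) unfolding conflation_def by blast
    moreover have "x \<odot> h \<in> Mor D W S" using Cmp_closed[OF that(1) s(1,2) that(2) s(4)] .
    moreover have "y \<odot> (x \<odot> h) = \<one>\<^bsub>Hom D W C\<^esub>"
      using Cmp_assoc[OF that(1) s(1,2,3) that(2) s(4,5)] etriangle_Cmp_zero[OF S(1)]
        Cmp_zero_left[OF that(1) s(1,3) that(2)] by simp
    ultimately have "\<exists>!g. g \<in> Mor D W F \<and> x \<odot> g = x \<odot> h" using that(1) by (simp add: is_kernel_def)
    then show ?thesis using that by metis
  qed
  show ?thesis
  proof (cases "zero_object D S")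
    case True
    \<comment> \<open>Here \<open>x\<close> is both zero and monic, which kills the identity of
      \<open>F\<close>.\<close>
    have "x = \<one>\<^bsub>Hom D F S\<^esub>" using True s trivial_Hom_zero by (simp add: zero_object_def)
    then have "x \<odot> Idt D F = x \<odot> \<one>\<^bsub>Hom D F F\<^esub>"
      using Cmp_Idt_right[OF s(1,2,4)] Cmp_zero_right[OF s(1,1,2,4)] by simp
    then show ?thesis
      using zero_objectI[OF FO] mono[OF FO Idt_closed[OF FO] zero_Mor[OF FO FO]] by blast
  next
    case False
    have "C \<in> Gen D V" using Gen_cokernel_of_perp0[OF S(1) _ S(2) False] F by blast
    then have CP: "C \<in> Pres D V" using tilting by (simp add: extended_tilting_def)
    have "\<exists>j \<in> Mor D C S. y \<odot> j = Idt D C"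
    proof (cases "zero_object D C")
      case True
      then have "Idt D C = \<one>\<^bsub>Hom D C C\<^esub>"
        using trivial_Hom_zero Idt_closed s(3) by (simp add: zero_object_def)
      then show ?thesis using zero_Mor[OF s(3,2)] Cmp_zero_right[OF s(3,2,3,5)] by auto
    next
      case False
      obtain \<alpha> :: "'m set" and \<iota> Q A a f \<kappa> where Q: "is_copower D V \<alpha> Q \<iota>"
        "etriangle D A Q C a f \<kappa>" "A \<in> Gen D V"
        using CP False unfolding Pres_def conflation_def by blast
      note q = etriangleD[OF Q(2)]
      have \<iota>: "\<iota> i \<in> Mor D V Q" if "i \<in> \<alpha>" for i using Q(1) that by (simp add: is_copower_def)
      have fi: "f \<odot> \<iota> i \<in> Mor D V C" if "i \<in> \<alpha>" for i
        using Cmp_closed[OF V_Ob q(2,3) \<iota>[OF that] q(5)] .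
      have "\<exists>g. g \<in> Mor D V S \<and> y \<odot> g = f \<odot> \<iota> i" if i: "i \<in> \<alpha>" for i
      proof -
        \<comment> \<open>The obstruction to lifting \<open>f \<odot> \<iota> i\<close> to
          \<open>S\<close> lies in \<open>Ext D V F\<close>, which is trivial.\<close>
        have "pull D F \<delta> (f \<odot> \<iota> i) = \<one>\<^bsub>Ext D V F\<^esub>"
          using pull_closed[OF s(3) V_Ob FO fi[OF i] s(6)] F by (simp add: perp1_def trivial_group_def)
        then show ?thesis using lift_through_deflation[OF S(1) V_Ob fi[OF i]] by metis
      qed
      then obtain g where g: "\<And>i. i \<in> \<alpha> \<Longrightarrow> g i \<in> Mor D V S \<and> y \<odot> g i = f \<odot> \<iota> i" by metis
      have copower: "\<exists>!h. h \<in> Mor D Q Y \<and> (\<forall>i\<in>\<alpha>. h \<odot> \<iota> i = k i)"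
        if "Y \<in> Ob D" "\<And>i. i \<in> \<alpha> \<Longrightarrow> k i \<in> Mor D V Y" for Y k
        using Q(1) that unfolding is_copower_def by blast
      obtain h where h: "h \<in> Mor D Q S" "\<And>i. i \<in> \<alpha> \<Longrightarrow> h \<odot> \<iota> i = g i"
        using copower[OF s(2), of g] g by blast
      have yh: "y \<odot> h \<in> Mor D Q C" using Cmp_closed[OF q(2) s(2,3) h(1) s(5)] .
      have yhi: "(y \<odot> h) \<odot> \<iota> i = f \<odot> \<iota> i" if "i \<in> \<alpha>" for i
        using Cmp_assoc[OF V_Ob q(2) s(2,3) \<iota>[OF that] h(1) s(5)] h(2)[OF that] g[OF that] by simp
      have "\<exists>!k. k \<in> Mor D Q C \<and> (\<forall>i\<in>\<alpha>. k \<odot> \<iota> i = f \<odot> \<iota> i)"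
        using copower[OF s(3), of "\<lambda>i. f \<odot> \<iota> i"] fi by blast
      then have yhf: "y \<odot> h = f" using yhi yh q(5) by blast
      have ha: "h \<odot> a \<in> Mor D A S" using Cmp_closed[OF q(1,2) s(2) q(4) h(1)] .
      have "y \<odot> (h \<odot> a) = \<one>\<^bsub>Hom D A C\<^esub>"
        using Cmp_assoc[OF q(1,2) s(2,3) q(4) h(1) s(5)] yhf etriangle_Cmp_zero[OF Q(2)] by simp
      then obtain u where u: "u \<in> Mor D A F" "x \<odot> u = h \<odot> a"
        using factor_through_inflation[OF S(1) q(1) ha] by blast
      have "u = \<one>\<^bsub>Hom D A F\<^esub>" using Hom_Gen_perp0[OF Q(3) _ u(1)] F by blast
      then have "h \<odot> a = \<one>\<^bsub>Hom D A S\<^esub>" using u(2) Cmp_zero_right[OF q(1) s(1,2,4)] by simp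
      then obtain j where j: "j \<in> Mor D C S" "j \<odot> f = h"
        using factor_through_deflation[OF Q(2) s(2) h(1)] by blast
      have cok: "is_cokernel D A Q C a f" using ker Q(2) unfolding conflation_def by blast
      have yjf: "(y \<odot> j) \<odot> f = f"
        using Cmp_assoc[OF q(2,3) s(2,3) q(5) j(1) s(5)] j(2) yhf by simp
      \<comment> \<open>A cokernel is epi, so \<open>f\<close> cancels from
        \<open>(y \<odot> j) \<odot> f = f\<close>.\<close>
      have "\<exists>!k. k \<in> Mor D C C \<and> k \<odot> f = f"
        using cok q(3,5) etriangle_Cmp_zero[OF Q(2)] by (simp add: is_cokernel_def)
      then have "y \<odot> j = Idt D C"
        using yjf Cmp_closed[OF s(3,2,3) j(1) s(5)] Idt_closed[OF s(3)] Cmp_Idt_left[OF q(2,3,5)]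
        by metis
      then show ?thesis using j(1) by blast
    qed
    then obtain j where j: "j \<in> Mor D C S" "y \<odot> j = Idt D C" by blast
    \<comment> \<open>The section \<open>j\<close> splits the conflation; the resulting retraction
      of \<open>x\<close> goes from torsion to torsion-free, hence is zero.\<close>
    have "\<delta> = pull D F (pull D F \<delta> y) j"
      using pull_pull[OF s(3,2,3,1,5) j(1) s(6)] j(2) pull_Idt[OF s(3,1,6)] by simp
    also have "\<dots> = \<one>\<^bsub>Ext D C F\<^esub>"
      using etriangle_pull_zero[OF S(1)] pull_one[OF s(2,3,1) j(1)] by simp
    finally have "push D C (Idt D F) \<delta> = \<one>\<^bsub>Ext D C F\<^esub>" using push_Idt[OF s(3,1,6)] by simp
    then obtain r where r: "r \<in> Mor D S F" "r \<odot> x = Idt D F"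
      using extend_along_inflation[OF S(1) FO Idt_closed[OF FO]] by blast
    have "r = \<one>\<^bsub>Hom D S F\<^esub>" using Hom_Gen_perp0[OF S(2) _ r(1)] F by blast
    then show ?thesis using zero_objectI[OF FO] r(2) Cmp_zero_left[OF s(1,2,1,4)] by simp
  qed
qed

text \<open>The torsion-free part of an object of \<open>perp1 D V\<close> lies in
  \<open>perp0 D V \<inter> perp1 D V\<close>, so it is zero and the object is isomorphic to its
  torsion part.\<close>

lemma Gen_eq_perp1_if_exact:
  assumes "exact_category D"
  shows "Gen D V = perp1 D V"
proof
  show "Gen D V \<subseteq> perp1 D V" by (rule Gen_subset_perp1)
  show "perp1 D V \<subseteq> Gen D V"
  proof
    fix X assume X: "X \<in> perp1 D V"
    then have XO: "X \<in> Ob D" by (simp add: perp1_def)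
    obtain T F x y \<delta> where T: "etriangle D T X F x y \<delta>" "T \<in> Gen D V" "F \<in> perp0 D V"
      using torsion_triangle[OF XO] by blast
    note t = etriangleD[OF T(1)]
    have "F \<in> perp0 D V \<inter> perp1 D V"
      using perp1_torsionfree_part[OF T] X by (simp add: perp1_def)
    moreover have "\<forall>A B C x y. conflation D A B C x y \<longrightarrow>
        is_kernel D A B C x y \<and> is_cokernel D A B C x y"
      using assms unfolding exact_category_def by (rule conjunct1)
    ultimately have Z: "zero_object D F" using torsionfree_perp1_zero_if_kernels_cokernels by blast
    have y0: "y = \<one>\<^bsub>Hom D X F\<^esub>" and id0: "Idt D F = \<one>\<^bsub>Hom D F F\<^esub>"
      using Z t Idt_closed[OF t(3)] trivial_Hom_zero by (simp_all add: zero_object_def)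
    \<comment> \<open>\<open>x\<close> has a section because \<open>y\<close> is zero, and a
      retraction because \<open>\<delta>\<close> is zero; the two agree.\<close>
    have "y \<odot> Idt D X = \<one>\<^bsub>Hom D X F\<^esub>" using y0 Cmp_Idt_right[OF t(2,3,5)] by simp
    then obtain s where s: "s \<in> Mor D X T" "x \<odot> s = Idt D X"
      using factor_through_inflation[OF T(1) XO Idt_closed[OF XO]] by blast
    have "\<delta> = \<one>\<^bsub>Ext D F T\<^esub>"
      using pull_Idt[OF t(3,1,6)] pull_zero[OF t(3,3,1,6)] id0 by simp
    then have "push D F (Idt D T) \<delta> = \<one>\<^bsub>Ext D F T\<^esub>" using push_Idt[OF t(3,1,6)] by simp
    then obtain r where r: "r \<in> Mor D X T" "r \<odot> x = Idt D T"
      using extend_along_inflation[OF T(1) t(1) Idt_closed[OF t(1)]] by blast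
    have "r = r \<odot> (x \<odot> s)" using s(2) Cmp_Idt_right[OF t(2,1) r(1)] by simp
    also have "\<dots> = s"
      using Cmp_assoc[OF t(2,1,2,1) s(1) t(4) r(1)] r(2) Cmp_Idt_left[OF t(2,1) s(1)] by simp
    finally have "isomorphism D T X x" using r s t(4) by (auto simp: isomorphism_def)
    then show "X \<in> Gen D V"
      using torsion_pair T(2) XO unfolding s_torsion_pair_def iso_closed_def by blast
  qed
qed

end

theorem proposition5p11:
  fixes D :: "('o, 'm, 'e, 'n) neg_extri_cat" and V :: 'o and \<T> \<F> :: "'o set"
  assumes "neg_extriangulated_category D"
    and "extended_tilting D V"
    and "\<T> = Gen D V" and "\<F> = perp0 D V"
  shows
    "((\<forall>F \<in> \<F> \<inter> perp1 D V. \<exists>T \<in> \<T>. \<not> zero_object D T \<and> (\<exists>C' x y. conflation D F T C' x y))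
      \<or> (\<forall>F \<in> \<F> \<inter> perp1 D V. \<forall>Z C' x y. zero_object D Z \<and> conflation D F Z C' x y
           \<longrightarrow> C' \<in> \<F> \<inter> perp1 D V)
      \<or> \<T> = perp1 D V
      \<longrightarrow> pd D V \<le> 1)
     \<and> (exact_category D \<longrightarrow> \<T> = perp1 D V)"
proof -
  interpret neg_extriangulated_category D by (rule assms(1))
  interpret extended_tilting_object D V by unfold_locales (rule assms(2))
  show ?thesis
    using pd_le_1_if Gen_eq_perp1_if_exact unfolding assms(3,4) by blast
qed

end
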